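(* There is an absolute constant $C$ such that the following holds. Let $\tau=k^{-7}$ and $t=\frac{1}{\tau^2}\big(3\ln(1/\tau)+\ln R\big)+\lceil 4k^2\ln k\rceil\cdot\big\lceil\frac{4}{\tau^2}\ln(1/\tau)\big\rceil$. Let $h(\vec y)=\mathrm{sgn}(\langle\vec w,\vec y\rangle-\theta)$ be a halfspace on $\{0,1\}^{kR}$ such that $B_t(\vec w_i)\cap B_t(\vec w_j)=\emptyset$ for all $i\ne j\in[k]$. Then $h$ passes the dictatorship test with probability at most $\frac12+\frac Ck$.
   Context: $\mathrm{sgn}(t)=1$ if $t\ge0$, else $0$. Fix integers $k\ge2$, $R\ge1$, and distributions $\mathcal D_0,\mathcal D_1$ on $\{0,1\}^k$ with $\Pr_{\mathcal D_0}[\text{all }x_l=0]\ge 1-2/\sqrt k$, $\Pr_{\mathcal D_1}[\text{all }x_l=0]\le 1/\sqrt k$, and matching moments up to degree $4$ (i.e. $\mathbb E[\prod_{i\in S}x_i]$ agrees under both for every multiset $S\subseteq[k]$, $|S|\le4$). Points of $\{0,1\}^{kR}$ are $k\times R$ matrices $\vec y=(y_i^{(j)})$; for $\vec w\in\mathbb R^{k\times R}$, $\vec w_i\in\mathbb R^R$ is its $i$-th row. Dictatorship test on $h$: pick a uniform bit $b$; draw the $R$ columns of $\vec x$ independently from $\mathcal D_b$; independently for each $(i,j)$ set $y_i^{(j)}=x_i^{(j)}$ w.p. $1-1/k^2$ and a fresh uniform bit w.p. $1/k^2$; accept iff $h(\vec y)=b$. For $\vec u\in\mathbb R^n$, order the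 indices as $i_1,\dots,i_n$ by decreasing $|u^{(i)}|$ with ties broken by increasing index, and let $B_t(\vec u)=\{i_1,\dots,i_{\min(t,n)}\}$. *)

theory Defs
  imports "HOL-Probability.Probability"
begin

definition noise_pmf :: "nat \<Rightarrow> bool \<Rightarrow> bool pmf" where
  "noise_pmf k b = bind_pmf (bernoulli_pmf (1 / (real k)^2))
      (\<lambda>c. if c then bernoulli_pmf (1/2) else return_pmf b)"

text \<open>The halfspace sgn(<w,y> - theta) on k x R matrices y (entry (i,j) = y_i^(j)); True means 1.\<close>
definition halfspace :: "nat \<Rightarrow> nat \<Rightarrow> (nat \<Rightarrow> nat \<Rightarrow> real) \<Rightarrow> real \<Rightarrow> (nat \<times> nat \<Rightarrow> bool) \<Rightarrow> bool" where
  "halfspace k R w \<theta> y \<longleftrightarrow> (\<Sum>i<k. \<Sum>j<R. w i j * of_bool (y (i,j))) - \<theta> \<ge> 0"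

text \<open>Distribution of the acceptance event of the dictatorship test on h
  (bit b = True means b = 1; column j of x is X j, drawn from D_b).\<close>
definition dict_test :: "nat \<Rightarrow> nat \<Rightarrow> (nat \<Rightarrow> bool) pmf \<Rightarrow> (nat \<Rightarrow> bool) pmf
    \<Rightarrow> ((nat \<times> nat \<Rightarrow> bool) \<Rightarrow> bool) \<Rightarrow> bool pmf" where
  "dict_test k R D0 D1 h =
     bind_pmf (bernoulli_pmf (1/2)) (\<lambda>b.
     bind_pmf (Pi_pmf {..<R} (\<lambda>_. False) (\<lambda>j. if b then D1 else D0)) (\<lambda>X.
     bind_pmf (Pi_pmf ({..<k} \<times> {..<R}) False (\<lambda>(i,j). noise_pmf k (X j i))) (\<lambda>y.
     return_pmf (h y = b))))"

definition accept_prob :: "nat \<Rightarrow> nat \<Rightarrow> (nat \<Rightarrow> bool) pmf \<Rightarrow> (nat \<Rightarrow> bool) pmf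
    \<Rightarrow> ((nat \<times> nat \<Rightarrow> bool) \<Rightarrow> bool) \<Rightarrow> real" where
  "accept_prob k R D0 D1 h = measure_pmf.prob (dict_test k R D0 D1 h) {True}"

definition prec_idx :: "(nat \<Rightarrow> real) \<Rightarrow> nat \<Rightarrow> nat \<Rightarrow> bool" where
  "prec_idx u j' j \<longleftrightarrow> \<bar>u j'\<bar> > \<bar>u j\<bar> \<or> (\<bar>u j'\<bar> = \<bar>u j\<bar> \<and> j' < j)"

text \<open>B_t(u) for u in R^n (indices 0..n-1): the indices whose position (1-based) in the order is at most t.\<close>
definition top_idx :: "real \<Rightarrow> nat \<Rightarrow> (nat \<Rightarrow> real) \<Rightarrow> nat set" where
  "top_idx t n u = {j. j < n \<and> real (card {j'. j' < n \<and> prec_idx u j' j}) + 1 \<le> t}"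

definition good_dists :: "nat \<Rightarrow> (nat \<Rightarrow> bool) pmf \<Rightarrow> (nat \<Rightarrow> bool) pmf \<Rightarrow> bool" where
  "good_dists k D0 D1 \<longleftrightarrow>
     set_pmf D0 \<subseteq> {x. \<forall>i\<ge>k. \<not> x i} \<and> set_pmf D1 \<subseteq> {x. \<forall>i\<ge>k. \<not> x i} \<and>
     measure_pmf.prob D0 {x. \<forall>l<k. \<not> x l} \<ge> 1 - 2 / sqrt (real k) \<and>
     measure_pmf.prob D1 {x. \<forall>l<k. \<not> x l} \<le> 1 / sqrt (real k) \<and>
     (\<forall>S :: nat multiset. set_mset S \<subseteq> {..<k} \<and> size S \<le> 4 \<longrightarrow>
        measure_pmf.expectation D0 (\<lambda>x. \<Prod>i\<in>#S. (of_bool (x i) :: real)) =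
        measure_pmf.expectation D1 (\<lambda>x. \<Prod>i\<in>#S. (of_bool (x i) :: real)))"

end

theory Submission
  imports Defs
begin

text \<open>
  The acceptance probability exceeds \<open>1/2\<close> by half the difference of the probabilities that the
  halfspace outputs 1 under the two noisy matrix distributions. Each row of \<open>w\<close> has a head inside
  \<open>B\<^sub>t\<close> such that either the tail after it is \<open>\<tau>\<close>-regular, or the head contains \<open>\<lceil>4 k\<^sup>2 ln k\<rceil>\<close>
  geometrically decreasing coefficients that dominate the tail. In the second case at most one pattern
  of the bits at these coefficients can put the sum near the threshold, and the noise makes every
  pattern unlikely, so the tail may be set to zero.

  Afterwards all tails are regular and every column meets at most one head. The step function is
  replaced by a spline at scale \<open>\<sigma> / k\<^sup>2\<close>, where \<open>\<sigma>\<^sup>2\<close> is the total energy of the tails; the noise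
  spreads the sum over the scale \<open>\<sigma> / k\<close> by Esseen's inequality, so this costs \<open>O(1/k)\<close>.
  The columns are then exchanged one by one: the third-order Taylor polynomial in the tail of a column,
  with coefficients depending on the single head bit, has degree four in the bits, so its expectation
  is the same under both distributions, and regularity bounds the sum of the remainders.
\<close>

section \<open>Finitely supported distributions\<close>

text \<open>Every distribution that occurs has finite support, so expectations are finite sums and
  integrability is automatic.\<close>

lemma expectation_bind_pmf_finite:
  fixes h :: "'b \<Rightarrow> 'c::{banach, second_countable_topology}"
  assumes "finite (set_pmf p)" "\<And>x. x \<in> set_pmf p \<Longrightarrow> finite (set_pmf (f x))"
  shows "measure_pmf.expectation (bind_pmf p f) h =
    measure_pmf.expectation p (\<lambda>x. measure_pmf.expectation (f x) h)"
proof -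
  have "measure_pmf.expectation (bind_pmf p f) h =
      (\<Sum>a\<in>set_pmf p. pmf p a *\<^sub>R measure_pmf.expectation (f a) h)"
    using assms by (intro pmf_expectation_bind) auto
  also have "\<dots> = measure_pmf.expectation p (\<lambda>x. measure_pmf.expectation (f x) h)"
    using assms by (subst integral_measure_pmf[of "set_pmf p"]) auto
  finally show ?thesis .
qed

lemma expectation_bool_pmf:
  fixes h :: "bool \<Rightarrow> 'c::{banach, second_countable_topology}"
  shows "measure_pmf.expectation p h = pmf p True *\<^sub>R h True + pmf p False *\<^sub>R h False"
  by (subst integral_measure_pmf[of UNIV]) (auto simp: UNIV_bool add.commute)

lemma pmf_bool_sum: "pmf p True + pmf p False = 1"
  using expectation_bool_pmf[of p "\<lambda>_. 1::real"] by simp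

lemma finite_set_Pi_pmf:
  assumes "finite J" "\<And>j. j \<in> J \<Longrightarrow> finite (set_pmf (p j))"
  shows "finite (set_pmf (Pi_pmf J d p))"
  using assms by (subst set_Pi_pmf) auto

lemma expectation_Pi_pmf_insert:
  fixes h :: "('a \<Rightarrow> 'b) \<Rightarrow> 'c::{banach, second_countable_topology}"
  assumes "finite A" "x \<notin> A" "\<And>j. j \<in> insert x A \<Longrightarrow> finite (set_pmf (p j))"
  shows "measure_pmf.expectation (Pi_pmf (insert x A) d p) h =
    measure_pmf.expectation (p x) (\<lambda>y. measure_pmf.expectation (Pi_pmf A d p) (\<lambda>f. h (f(x := y))))"
proof -
  have "Pi_pmf (insert x A) d p = bind_pmf (p x) (\<lambda>y. map_pmf (\<lambda>f. f(x := y)) (Pi_pmf A d p))"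
    using assms by (simp add: Pi_pmf_insert' map_pmf_def)
  then show ?thesis
    using assms by (simp add: expectation_bind_pmf_finite finite_set_Pi_pmf)
qed

lemma expectation_prod_Pi_pmf_finite:
  fixes f :: "'a \<Rightarrow> 'b \<Rightarrow> 'c::{real_normed_field, banach, second_countable_topology}"
  assumes "finite A" "\<And>j. j \<in> A \<Longrightarrow> finite (set_pmf (p j))"
  shows "measure_pmf.expectation (Pi_pmf A d p) (\<lambda>y. \<Prod>j\<in>A. f j (y j)) =
    (\<Prod>j\<in>A. measure_pmf.expectation (p j) (f j))"
  using assms
proof (induction A rule: finite_induct)
  case (insert x A)
  have "(\<Prod>j\<in>insert x A. f j ((g(x := y)) j)) = f x y * (\<Prod>j\<in>A. f j (g j))" for g y
    using insert.hyps by (auto intro!: prod.cong)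
  then have "measure_pmf.expectation (Pi_pmf (insert x A) d p) (\<lambda>y. \<Prod>j\<in>insert x A. f j (y j)) =
      measure_pmf.expectation (p x) (\<lambda>y. f x y * measure_pmf.expectation (Pi_pmf A d p) (\<lambda>g. \<Prod>j\<in>A. f j (g j)))"
    using insert.hyps insert.prems by (subst expectation_Pi_pmf_insert) (auto simp only: integral_mult_right_zero)
  then show ?case
    using insert by simp
qed simp

lemma expectation_mono_finite:
  fixes f g :: "'a \<Rightarrow> real"
  assumes "finite (set_pmf p)" "\<And>x. x \<in> set_pmf p \<Longrightarrow> f x \<le> g x"
  shows "measure_pmf.expectation p f \<le> measure_pmf.expectation p g"
  using assms by (intro integral_mono_AE) (auto simp: AE_measure_pmf_iff integrable_measure_pmf_finite)

text \<open>Conditioning: a bound uniform in the first draw survives averaging over it. This permits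
  arguments that use only part of the randomness.\<close>

lemma prob_bind_pmf_le:
  assumes "finite (set_pmf p)" "\<And>x. x \<in> set_pmf p \<Longrightarrow> finite (set_pmf (f x))"
    and "\<And>x. x \<in> set_pmf p \<Longrightarrow> measure_pmf.prob (f x) E \<le> c"
  shows "measure_pmf.prob (bind_pmf p f) E \<le> c"
proof -
  have "measure_pmf.prob (bind_pmf p f) E = measure_pmf.expectation (bind_pmf p f) (indicator E)"
    by simp
  also have "\<dots> = measure_pmf.expectation p (\<lambda>x. measure_pmf.prob (f x) E)"
    using assms by (simp only: expectation_bind_pmf_finite) simp
  also have "\<dots> \<le> measure_pmf.expectation p (\<lambda>_. c)"
    using assms by (intro expectation_mono_finite) auto
  finally show ?thesis by simp
qed

lemma abs_expectation_diff_le: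
  fixes f g :: "'a \<Rightarrow> real"
  assumes fin: "finite (set_pmf p)" and le: "\<And>x. x \<in> set_pmf p \<Longrightarrow> \<bar>f x - g x\<bar> \<le> e"
  shows "\<bar>measure_pmf.expectation p f - measure_pmf.expectation p g\<bar> \<le> e"
proof -
  have "measure_pmf.expectation p f - measure_pmf.expectation p g = measure_pmf.expectation p (\<lambda>x. f x - g x)"
    using fin by (subst Bochner_Integration.integral_diff) (auto intro: integrable_measure_pmf_finite)
  also have "\<bar>\<dots>\<bar> \<le> measure_pmf.expectation p (\<lambda>x. \<bar>f x - g x\<bar>)"
    by (rule integral_abs_bound)
  also have "\<dots> \<le> measure_pmf.expectation p (\<lambda>_. e)"
    using fin le by (rule expectation_mono_finite)
  finally show ?thesis by simp
qed

lemma expectation_swap_finite: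
  fixes F :: "'a \<Rightarrow> 'b \<Rightarrow> real"
  assumes "finite (set_pmf p)" "finite (set_pmf q)"
  shows "measure_pmf.expectation p (\<lambda>x. measure_pmf.expectation q (F x)) =
    measure_pmf.expectation q (\<lambda>y. measure_pmf.expectation p (\<lambda>x. F x y))"
  using assms
  by (simp add: integral_measure_pmf[of "set_pmf p"] integral_measure_pmf[of "set_pmf q"] sum_distrib_left mult_ac)
    (rule sum.swap)

section \<open>Anticoncentration\<close>

text \<open>The cosine transform of a triangle: a kernel that involves only frequencies in
  \<open>[0, 1]\<close> and is still nonnegative.\<close>

definition fejer :: "real \<Rightarrow> real" where
  "fejer s = integral {0..1} (\<lambda>t. (1 - t) * cos (t * s))"

lemma cos_ge_quadratic: "1 - s\<^sup>2 / 2 \<le> cos (s::real)"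
proof -
  have "cos s = 1 - 2 * (sin (s/2))\<^sup>2"
    using cos_double_sin[of "s/2"] by simp
  moreover have "(sin (s/2))\<^sup>2 \<le> (s/2)\<^sup>2"
    using abs_sin_x_le_abs_x[of "s/2"] using abs_le_square_iff by blast
  ultimately show ?thesis by (simp add: power2_eq_square)
qed

text \<open>Integration by parts yields \<open>(1 - cos s) / s\<^sup>2\<close> for nonzero
  \<open>s\<close>; at \<open>s = 0\<close> the integrand itself is nonnegative.\<close>

lemma fejer_nonneg: "0 \<le> fejer s"
proof (cases "s = 0")
  case True
  then show ?thesis unfolding fejer_def
    by (intro integral_nonneg integrable_continuous_interval continuous_intros) auto
next
  case False
  have "((\<lambda>t. (1 - t) * cos (t * s)) has_integral
      ((1 - 1) * sin (1 * s) / s - cos (1 * s) / s\<^sup>2) - ((1 - 0) * sin (0 * s) / s - cos (0 * s) / s\<^sup>2)) {0..1}"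
    using False
    by (intro fundamental_theorem_of_calculus)
      (auto intro!: derivative_eq_intros simp flip: has_real_derivative_iff_has_vector_derivative
        simp: field_simps power2_eq_square)
  then have "fejer s = (1 - cos s) / s\<^sup>2"
    unfolding fejer_def by (simp add: integral_unique diff_divide_distrib)
  then show ?thesis by simp
qed

text \<open>For these arguments the cosine stays above \<open>1/2\<close>, and
  \<open>(1 - t) / 2\<close> integrates to \<open>1/4\<close>. Together with nonnegativity,
  \<open>4 * fejer\<close> dominates the indicator of \<open>[-1, 1]\<close>.\<close>

lemma fejer_ge:
  assumes "\<bar>s\<bar> \<le> 1"
  shows "1/4 \<le> fejer s"
proof -
  have "((\<lambda>t. (1 - t) * (1/2)) has_integral (1/2 * 1 - 1/4 * 1\<^sup>2) - (1/2 * 0 - 1/4 * 0\<^sup>2)) {0..1::real}"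
    by (intro fundamental_theorem_of_calculus)
      (auto intro!: derivative_eq_intros simp flip: has_real_derivative_iff_has_vector_derivative
        simp: field_simps power2_eq_square)
  then have "((\<lambda>t. (1 - t) * (1/2)) has_integral 1/4) {0..1::real}" by simp
  moreover have "((\<lambda>t. (1 - t) * cos (t * s)) has_integral fejer s) {0..1}"
    unfolding fejer_def
    by (intro integrable_integral integrable_continuous_interval continuous_intros)
  moreover have "(1 - t) * (1/2) \<le> (1 - t) * cos (t * s)" if "t \<in> {0..1}" for t
  proof -
    have "\<bar>t * s\<bar> \<le> 1" using that assms by (simp add: abs_mult mult_le_one)
    then have "(t * s)\<^sup>2 \<le> 1" by (simp add: abs_square_le_1)
    then have "1/2 \<le> cos (t * s)" using cos_ge_quadratic[of "t * s"] by simp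
    then show ?thesis using that by (intro mult_left_mono) auto
  qed
  ultimately show ?thesis by (rule has_integral_le)
qed

text \<open>The half-angle formula reduces this to \<open>sin x \<ge> 3/4 * x\<close> on
  \<open>[0, 1/2]\<close>, which follows from the cubic Taylor bound; squaring gives
  \<open>2 * 9/64 = 9/32\<close>, above \<open>1/4\<close>.\<close>

lemma one_minus_cos_ge:
  assumes "\<bar>s\<bar> \<le> 1"
  shows "s\<^sup>2 / 4 \<le> 1 - cos (s::real)"
proof -
  have "3/4 * \<bar>s/2\<bar> \<le> \<bar>sin (s/2)\<bar>"
  proof -
    have pos: "3/4 * x \<le> sin x" if "0 \<le> x" "x \<le> 1/2" for x :: real
    proof -
      have "x\<^sup>2 \<le> (1/2)\<^sup>2" using that by (intro power_mono) auto
      then have "x * x\<^sup>2 \<le> x * (1/4)" using that by (intro mult_left_mono) (auto simp: power2_eq_square)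
      moreover have "\<bar>sin x - x\<bar> \<le> x^3 / 6"
        using that Maclaurin_sin_bound[of x 3] by (simp add: numeral_3_eq_3 sin_coeff_def)
      moreover have "x * x\<^sup>2 = x^3" by (simp add: power2_eq_square power3_eq_cube)
      ultimately show ?thesis by linarith
    qed
    show ?thesis
      using pos[of "\<bar>s/2\<bar>"] assms by (cases "s \<ge> 0") auto
  qed
  then have "(3/4 * \<bar>s/2\<bar>)\<^sup>2 \<le> \<bar>sin (s/2)\<bar>\<^sup>2"
    by (intro power_mono) auto
  moreover have "cos s = 1 - 2 * (sin (s/2))\<^sup>2"
    using cos_double_sin[of "s/2"] by simp
  moreover have "(3/4 * \<bar>s/2\<bar>)\<^sup>2 = 9/64 * s\<^sup>2"
    by (simp add: power_mult_distrib power_divide)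
  ultimately show ?thesis
    using zero_le_power2[of "sin (s/2)"] unfolding power2_abs by linarith
qed

lemma cis_sum: "cis (sum f A) = (\<Prod>x\<in>A. cis (f x))"
  by (induction A rule: infinite_finite_induct) (simp_all flip: cis_mult)

text \<open>The squared modulus is exactly \<open>1 - 2 * a * b * (1 - cos s)\<close> with
  \<open>a\<close>, \<open>b\<close> the two probabilities, so the variance \<open>a * b\<close> of
  the bit sets the rate of Gaussian decay.\<close>

lemma norm_char_bool_le:
  assumes "\<bar>s\<bar> \<le> 1"
  shows "norm (measure_pmf.expectation p (\<lambda>y. cis (s * of_bool y))) \<le> exp (- (pmf p True * pmf p False * s\<^sup>2 / 4))"
proof -
  define a b where "a = pmf p True" and "b = pmf p False"
  have ab: "a \<ge> 0" "b \<ge> 0" "a = 1 - b" unfolding a_def b_def using pmf_bool_sum[of p] by auto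
  have "(norm (measure_pmf.expectation p (\<lambda>y. cis (s * of_bool y))))\<^sup>2 = (a * cos s + b)\<^sup>2 + (a * sin s)\<^sup>2"
    by (simp add: expectation_bool_pmf cmod_power2 a_def b_def)
  also have "\<dots> = a\<^sup>2 * ((sin s)\<^sup>2 + (cos s)\<^sup>2) + b\<^sup>2 + 2 * a * b * cos s"
    by algebra
  also have "\<dots> = 1 - 2 * a * b * (1 - cos s)"
    unfolding sin_cos_squared_add ab(3) by (simp add: power2_eq_square algebra_simps)
  also have "\<dots> \<le> 1 - 2 * a * b * (s\<^sup>2 / 4)"
    using one_minus_cos_ge[OF assms] ab(1,2) by (intro diff_left_mono mult_left_mono) auto
  also have "\<dots> \<le> exp (- (2 * a * b * (s\<^sup>2 / 4)))"
    using exp_ge_add_one_self[of "- (2 * a * b * (s\<^sup>2 / 4))"] by simp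
  also have "\<dots> = (exp (- (a * b * s\<^sup>2 / 4)))\<^sup>2"
    by (simp only: power2_eq_square[of "exp _"] flip: exp_add) simp
  finally show ?thesis
    unfolding a_def b_def by (rule power2_le_imp_le) simp
qed

text \<open>Comparison with \<open>1 / (1 + a * t\<^sup>2)\<close> turns the integral into an
  arctangent, which is below \<open>pi / 2\<close>.\<close>

lemma integral_gauss_le:
  assumes "a > 0"
  shows "integral {0..1} (\<lambda>t. exp (- (a * t\<^sup>2))) \<le> pi / (2 * sqrt a)"
proof -
  define r where "r = sqrt a"
  have r: "r > 0" "a = r\<^sup>2" using assms unfolding r_def by auto
  have "((\<lambda>t. 1 / (1 + (r * t)\<^sup>2)) has_integral arctan (r * 1) / r - arctan (r * 0) / r) {0..1}"
    using r
    by (intro fundamental_theorem_of_calculus)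
      (auto intro!: derivative_eq_intros simp flip: has_real_derivative_iff_has_vector_derivative
        simp: divide_inverse)
  moreover have "((\<lambda>t. exp (- (a * t\<^sup>2))) has_integral integral {0..1} (\<lambda>t. exp (- (a * t\<^sup>2)))) {0..1}"
    by (intro integrable_integral integrable_continuous_interval continuous_intros)
  moreover have "exp (- (a * t\<^sup>2)) \<le> 1 / (1 + (r * t)\<^sup>2)" for t
  proof -
    have "1 + a * t\<^sup>2 \<le> exp (a * t\<^sup>2)" by (rule exp_ge_add_one_self)
    then show ?thesis using assms
      by (auto simp: exp_minus r power_mult_distrib field_simps add_pos_nonneg intro!: divide_left_mono)
  qed
  ultimately have "integral {0..1} (\<lambda>t. exp (- (a * t\<^sup>2))) \<le> arctan (r * 1) / r - arctan (r * 0) / r"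
    by (meson has_integral_le)
  also have "\<dots> = arctan r / r" by simp
  also have "\<dots> \<le> (pi/2) / r" using arctan_ubound[of r] r by (simp add: field_simps)
  finally show ?thesis by (simp add: r_def)
qed

text \<open>Esseen's concentration inequality with the Fejer kernel: only the characteristic function at
  frequencies up to \<open>1 / l\<close> enters, where the small coefficients contribute Gaussian decay.\<close>

lemma Pi_pmf_bool_anticoncentration:
  fixes w :: "'a \<Rightarrow> real"
  assumes J: "finite J" "T \<subseteq> J" and l: "l > 0"
    and small: "\<And>j. j \<in> T \<Longrightarrow> \<bar>w j\<bar> \<le> l"
    and v: "v > 0" "\<And>j. j \<in> J \<Longrightarrow> v \<le> pmf (p j) True * pmf (p j) False"
    and W: "(\<Sum>j\<in>T. (w j)\<^sup>2) > 0"
  shows "measure_pmf.prob (Pi_pmf J d p) {y. \<bar>(\<Sum>j\<in>J. w j * of_bool (y j)) - c\<bar> \<le> l}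
    \<le> 4 * pi * l / sqrt (v * (\<Sum>j\<in>T. (w j)\<^sup>2))"
proof -
  define P where "P = Pi_pmf J d p"
  define W2 where "W2 = (\<Sum>j\<in>T. (w j)\<^sup>2)"
  define S where "S y = (\<Sum>j\<in>J. w j * of_bool (y j))" for y :: "'a \<Rightarrow> bool"
  \<comment> \<open>The frequency of bit \<open>j\<close> is \<open>t * w j / l\<close>, so the
    decay exponents \<open>v * (t * w j / l)\<^sup>2 / 4\<close> over \<open>T\<close> add up to
    \<open>a * t\<^sup>2\<close>.\<close>
  define a where "a = v * W2 / (4 * l\<^sup>2)"
  have a: "a > 0" using v W l unfolding a_def W2_def by simp
  have finP: "finite (set_pmf P)" unfolding P_def using J by (intro finite_set_Pi_pmf) auto
  have char: "measure_pmf.expectation P (\<lambda>y. cos (t * ((S y - c) / l))) \<le> exp (- (a * t\<^sup>2))"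
    if t: "t \<in> {0..1}" for t
  proof -
    define s where "s j = t * w j / l" for j
    have small_s: "\<bar>s j\<bar> \<le> 1" if "j \<in> T" for j
    proof -
      have "t * \<bar>w j\<bar> \<le> 1 * l" using t small[OF that] l by (intro mult_mono) auto
      then show ?thesis using t l unfolding s_def by (simp add: abs_mult field_simps)
    qed
    have "t * ((S y - c) / l) = (\<Sum>j\<in>J. s j * of_bool (y j)) - t * c / l" for y
      unfolding S_def s_def using l by (simp add: sum_distrib_left sum_divide_distrib algebra_simps diff_divide_distrib)
    then have eq: "cis (t * ((S y - c) / l)) = cis (- (t * c / l)) * (\<Prod>j\<in>J. cis (s j * of_bool (y j)))" for y
      by (simp only: cis_sum[symmetric] cis_mult) (simp only: add.commute diff_conv_add_uminus)
    have "measure_pmf.expectation P (\<lambda>y. cos (t * ((S y - c) / l))) =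
        Re (measure_pmf.expectation P (\<lambda>y. cis (t * ((S y - c) / l))))"
      using finP by (subst integral_Re[symmetric]) (auto simp: integrable_measure_pmf_finite)
    also have "\<dots> \<le> norm (measure_pmf.expectation P (\<lambda>y. cis (t * ((S y - c) / l))))"
      by (rule complex_Re_le_cmod)
    also have "\<dots> = norm (measure_pmf.expectation P (\<lambda>y. \<Prod>j\<in>J. cis (s j * of_bool (y j))))"
      unfolding eq by (simp add: norm_mult)
    also have "\<dots> = (\<Prod>j\<in>J. norm (measure_pmf.expectation (p j) (\<lambda>y. cis (s j * of_bool y))))"
      unfolding P_def using J by (subst expectation_prod_Pi_pmf_finite) (auto simp: prod_norm)
    \<comment> \<open>Frequencies at most 1 are guaranteed on \<open>T\<close>, where the Gaussian
      estimate applies; every other factor has modulus at most 1.\<close>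
    also have "\<dots> \<le> (\<Prod>j\<in>J. if j \<in> T then exp (- (v * (s j)\<^sup>2 / 4)) else 1)"
    proof (intro prod_mono conjI)
      fix j assume j: "j \<in> J"
      show "norm (measure_pmf.expectation (p j) (\<lambda>y. cis (s j * of_bool y))) \<le>
          (if j \<in> T then exp (- (v * (s j)\<^sup>2 / 4)) else 1)"
      proof (cases "j \<in> T")
        case True
        have "v * (s j)\<^sup>2 \<le> pmf (p j) True * pmf (p j) False * (s j)\<^sup>2"
          using v(2)[OF j] by (intro mult_right_mono) auto
        then show ?thesis
          using norm_char_bool_le[OF small_s[OF True], of "p j"] True by (auto elim: order_trans)
      next
        case False
        have "norm (measure_pmf.expectation (p j) (\<lambda>y. cis (s j * of_bool y))) \<le>
            measure_pmf.expectation (p j) (\<lambda>y. norm (cis (s j * of_bool y)))"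
          by (rule integral_norm_bound)
        then show ?thesis using False by simp
      qed
    qed auto
    also have "\<dots> = (\<Prod>j\<in>T. exp (- (v * (s j)\<^sup>2 / 4)))"
      using J by (subst prod.inter_restrict[symmetric]) (auto simp: Int_absorb1)
    also have "\<dots> = exp (\<Sum>j\<in>T. - (v * (s j)\<^sup>2 / 4))"
      using J finite_subset by (subst exp_sum) auto
    also have "(\<Sum>j\<in>T. - (v * (s j)\<^sup>2 / 4)) = - (a * t\<^sup>2)"
      unfolding a_def s_def W2_def
      by (simp add: power_mult_distrib power_divide sum_negf sum_distrib_left sum_distrib_right sum_divide_distrib mult_ac)
    finally show ?thesis .
  qed
  have int: "(\<lambda>t. (1 - t) * cos (t * s)) integrable_on {0..1::real}" for s
    by (intro integrable_continuous_interval continuous_intros)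
  have "measure_pmf.prob P {y. \<bar>S y - c\<bar> \<le> l} = measure_pmf.expectation P (indicator {y. \<bar>S y - c\<bar> \<le> l})"
    by simp
  also have "\<dots> \<le> measure_pmf.expectation P (\<lambda>y. 4 * fejer ((S y - c) / l))"
  proof (rule expectation_mono_finite[OF finP])
    fix y
    show "indicator {y. \<bar>S y - c\<bar> \<le> l} y \<le> 4 * fejer ((S y - c) / l)"
      using fejer_nonneg[of "(S y - c) / l"] fejer_ge[of "(S y - c) / l"] l
      by (auto simp: indicator_def)
  qed
  also have "\<dots> = 4 * (\<Sum>y\<in>set_pmf P. pmf P y * fejer ((S y - c) / l))"
    using finP by (subst integral_measure_pmf[of "set_pmf P"]) (auto simp: sum_distrib_left mult_ac)
  \<comment> \<open>Exchanging the finite sum with the integral brings the real part of the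
    characteristic function under the integral.\<close>
  also have "(\<Sum>y\<in>set_pmf P. pmf P y * fejer ((S y - c) / l)) =
      integral {0..1} (\<lambda>t. \<Sum>y\<in>set_pmf P. pmf P y * ((1 - t) * cos (t * ((S y - c) / l))))"
    unfolding fejer_def using finP int
    by (subst integral_sum) (auto intro!: integrable_on_mult_right simp del: times_divide_eq_right)
  also have "\<dots> \<le> integral {0..1} (\<lambda>t. exp (- (a * t\<^sup>2)))"
  proof (rule integral_le)
    show "(\<lambda>t. \<Sum>y\<in>set_pmf P. pmf P y * ((1 - t) * cos (t * ((S y - c) / l)))) integrable_on {0..1}"
      using finP int by (auto intro!: integrable_sum integrable_on_mult_right simp del: times_divide_eq_right)
    show "(\<lambda>t. exp (- (a * t\<^sup>2))) integrable_on {0..1}"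
      by (intro integrable_continuous_interval continuous_intros)
    fix t :: real assume t: "t \<in> {0..1}"
    have "(\<Sum>y\<in>set_pmf P. pmf P y * ((1 - t) * cos (t * ((S y - c) / l)))) =
        (1 - t) * measure_pmf.expectation P (\<lambda>y. cos (t * ((S y - c) / l)))"
      using finP by (subst integral_measure_pmf[of "set_pmf P"]) (auto simp: sum_distrib_left mult_ac)
    also have "\<dots> \<le> (1 - t) * exp (- (a * t\<^sup>2))"
      using char[OF t] t by (intro mult_left_mono) auto
    also have "\<dots> \<le> 1 * exp (- (a * t\<^sup>2))"
      using t by (intro mult_right_mono) auto
    finally show "(\<Sum>y\<in>set_pmf P. pmf P y * ((1 - t) * cos (t * ((S y - c) / l)))) \<le> exp (- (a * t\<^sup>2))"
      by simp
  qed
  also have "\<dots> \<le> pi / (2 * sqrt a)" by (rule integral_gauss_le[OF a])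
  also have "sqrt a = sqrt (v * W2) / (2 * l)"
    unfolding a_def using l by (simp add: real_sqrt_divide real_sqrt_mult)
  finally show ?thesis
    unfolding P_def S_def W2_def using l by (simp add: mult_ac)
qed

section \<open>Sums with geometrically decreasing coefficients\<close>

text \<open>The constant \<open>3/2\<close> means that all later terms together weigh at most half
  of the first one.\<close>

lemma geometric_sum_le:
  fixes g :: "nat \<Rightarrow> real"
  assumes "\<And>a. Suc a < m \<Longrightarrow> \<bar>g (Suc a)\<bar> \<le> \<bar>g a\<bar> / 3"
  shows "(\<Sum>a<m. \<bar>g a\<bar>) \<le> 3/2 * \<bar>g 0\<bar>"
  using assms
proof (induction m arbitrary: g)
  case (Suc m)
  show ?case
  proof (cases "m = 0")
    case False
    have "(\<Sum>a<m. \<bar>g (Suc a)\<bar>) \<le> 3/2 * \<bar>g (Suc 0)\<bar>"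
      using Suc.prems by (intro Suc.IH) auto
    also have "\<dots> \<le> 1/2 * \<bar>g 0\<bar>" using Suc.prems[of 0] False by simp
    finally show ?thesis unfolding sum.lessThan_Suc_shift by simp
  qed simp
qed simp

text \<open>Think of \<open>d\<close> as the difference of two bit patterns. The term at the first
  place where they differ dominates: the later ones cancel at most half of it, and its coefficient
  is at least as large as the last one. The induction drops leading zeros of
  \<open>d\<close>.\<close>

lemma geometric_sums_separated:
  fixes g d :: "nat \<Rightarrow> real"
  assumes "\<And>a. Suc a < m \<Longrightarrow> \<bar>g (Suc a)\<bar> \<le> \<bar>g a\<bar> / 3"
    and "\<And>a. d a \<in> {-1, 0, 1}" and "\<exists>a<m. d a \<noteq> 0"
  shows "\<bar>g (m - 1)\<bar> / 2 \<le> \<bar>\<Sum>a<m. g a * d a\<bar>"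
  using assms
proof (induction m arbitrary: g d)
  case (Suc m)
  show ?case
  proof (cases "d 0 = 0")
    case True
    then obtain a where a: "a < m" "d (Suc a) \<noteq> 0"
      using Suc.prems(3) by (metis less_Suc_eq_0_disj)
    have "\<bar>g (Suc (m - 1))\<bar> / 2 \<le> \<bar>\<Sum>a<m. g (Suc a) * d (Suc a)\<bar>"
      using Suc.prems a by (intro Suc.IH[of "\<lambda>a. g (Suc a)" "\<lambda>a. d (Suc a)"]) auto
    moreover have "Suc (m - 1) = m" using a by simp
    ultimately show ?thesis using True unfolding sum.lessThan_Suc_shift by simp
  next
    case False
    have "\<bar>g a\<bar> \<le> \<bar>g 0\<bar>" if "a < Suc m" for a
      using that
    proof (induction a)
      case (Suc a)
      then show ?case using Suc.prems \<open>\<And>a. Suc a < Suc m \<Longrightarrow> \<bar>g (Suc a)\<bar> \<le> \<bar>g a\<bar> / 3\<close>[of a] by simp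
    qed simp
    then have gm: "\<bar>g m\<bar> \<le> \<bar>g 0\<bar>" by simp
    have "\<bar>\<Sum>a<m. g (Suc a) * d (Suc a)\<bar> \<le> (\<Sum>a<m. \<bar>g (Suc a)\<bar> * \<bar>d (Suc a)\<bar>)"
      unfolding abs_mult[symmetric] by (rule sum_abs)
    also have "\<dots> \<le> (\<Sum>a<m. \<bar>g (Suc a)\<bar> * 1)"
    proof (intro sum_mono mult_left_mono)
      show "\<bar>d (Suc a)\<bar> \<le> 1" for a using Suc.prems(2)[of "Suc a"] by auto
    qed simp
    also have "\<dots> = (\<Sum>a<Suc m. \<bar>g a\<bar>) - \<bar>g 0\<bar>" unfolding sum.lessThan_Suc_shift by simp
    also have "\<dots> \<le> 1/2 * \<bar>g 0\<bar>" using geometric_sum_le[of "Suc m" g] Suc.prems(1) by simp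
    finally have "\<bar>\<Sum>a<m. g (Suc a) * d (Suc a)\<bar> \<le> 1/2 * \<bar>g 0\<bar>" .
    moreover have "\<bar>g 0 * d 0\<bar> = \<bar>g 0\<bar>" using Suc.prems(2)[of 0] False by (auto simp: abs_mult)
    moreover have "\<bar>g 0 * d 0\<bar> - \<bar>\<Sum>a<m. g (Suc a) * d (Suc a)\<bar> \<le> \<bar>g 0 * d 0 + (\<Sum>a<m. g (Suc a) * d (Suc a))\<bar>"
      using abs_triangle_ineq2[of "g 0 * d 0" "- (\<Sum>a<m. g (Suc a) * d (Suc a))"] by (simp only: abs_minus_cancel diff_minus_eq_add)
    ultimately show ?thesis using gm unfolding sum.lessThan_Suc_shift by (simp del: abs_mult)
  qed
qed simp

text \<open>With the coordinates outside the image of \<open>g\<close> fixed, two patterns that both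
  land in the window have sums at most \<open>2 * r\<close> apart, against
  \<open>geometric_sums_separated\<close> unless they agree. So at most one pattern on these
  \<open>m\<close> places is possible, and its probability is a product of \<open>m\<close>
  factors.\<close>

lemma Pi_pmf_geometric_anticoncentration:
  fixes w :: "'a \<Rightarrow> real"
  assumes J: "finite J" and g: "inj_on g {..<m}" "g ` {..<m} \<subseteq> J"
    and geo: "\<And>a. Suc a < m \<Longrightarrow> \<bar>w (g (Suc a))\<bar> \<le> \<bar>w (g a)\<bar> / 3"
    and r: "2 * r < \<bar>w (g (m - 1))\<bar> / 2"
    and q: "\<And>j b. j \<in> J \<Longrightarrow> pmf (p j) b \<le> q"
  shows "measure_pmf.prob (Pi_pmf J d p) {y. \<bar>(\<Sum>j\<in>J. w j * of_bool (y j)) - c\<bar> \<le> r} \<le> q ^ m"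
proof -
  define G where "G = g ` {..<m}"
  define E where "E = {y. \<bar>(\<Sum>j\<in>J. w j * of_bool (y j)) - c\<bar> \<le> r}"
  have G: "finite G" "G \<subseteq> J" "card G = m" unfolding G_def using g by (auto simp: card_image)
  have "Pi_pmf J d p = Pi_pmf ((J - G) \<union> G) d p" using G by (simp add: Un_absorb2)
  also have "\<dots> = map_pmf (\<lambda>(f, h) x. if x \<in> J - G then f x else h x)
      (pair_pmf (Pi_pmf (J - G) d p) (Pi_pmf G d p))"
    using J G by (intro Pi_pmf_union) auto
  \<comment> \<open>The two-stage form allows the coordinates outside \<open>G\<close> to be fixed
    first.\<close>
  also have "\<dots> = bind_pmf (Pi_pmf (J - G) d p)
      (\<lambda>f. map_pmf (\<lambda>h x. if x \<in> J - G then f x else h x) (Pi_pmf G d p))"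
    by (simp add: pair_pmf_def map_bind_pmf map_pmf_def bind_assoc_pmf bind_return_pmf)
  finally have split: "Pi_pmf J d p = \<dots>" .
  have "measure_pmf.prob (Pi_pmf J d p) E \<le> q ^ m"
    unfolding split
  proof (rule prob_bind_pmf_le)
    show "finite (set_pmf (Pi_pmf (J - G) d p))" using J by (intro finite_set_Pi_pmf) auto
    fix f
    show "finite (set_pmf (map_pmf (\<lambda>h x. if x \<in> J - G then f x else h x) (Pi_pmf G d p)))"
      using G by (auto intro!: finite_set_Pi_pmf)
    define E' where "E' = {h. (\<lambda>x. if x \<in> J - G then f x else h x) \<in> E}"
    have sum: "(\<Sum>j\<in>J. w j * of_bool (if j \<in> J - G then f j else h j)) =
        (\<Sum>j\<in>J - G. w j * of_bool (f j)) + (\<Sum>a<m. w (g a) * of_bool (h (g a)))" for h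
    proof -
      have "(\<Sum>j\<in>J. w j * of_bool (if j \<in> J - G then f j else h j)) =
          (\<Sum>j\<in>J - G. w j * of_bool (if j \<in> J - G then f j else h j)) +
          (\<Sum>j\<in>G. w j * of_bool (if j \<in> J - G then f j else h j))"
        using J G by (intro sum.subset_diff) auto
      also have "(\<Sum>j\<in>G. w j * of_bool (if j \<in> J - G then f j else h j)) = (\<Sum>j\<in>G. w j * of_bool (h j))"
        by (intro sum.cong) auto
      also have "\<dots> = (\<Sum>a<m. w (g a) * of_bool (h (g a)))"
        unfolding G_def using g by (subst sum.reindex) auto
      also have "(\<Sum>j\<in>J - G. w j * of_bool (if j \<in> J - G then f j else h j)) = (\<Sum>j\<in>J - G. w j * of_bool (f j))"
        by (intro sum.cong) auto
      finally show ?thesis .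
    qed
    have agree: "h x = h' x" if h: "h \<in> E'" "h' \<in> E'" and x: "x \<in> G" for h h' x
    proof (rule ccontr)
      assume "h x \<noteq> h' x"
      then have "\<exists>a<m. h (g a) \<noteq> h' (g a)" using x unfolding G_def by auto
      then have "\<bar>w (g (m - 1))\<bar> / 2 \<le>
          \<bar>\<Sum>a<m. w (g a) * (of_bool (h (g a)) - of_bool (h' (g a)))\<bar>"
        using geo by (intro geometric_sums_separated) (auto simp: of_bool_def)
      also have "\<dots> \<le> 2 * r"
        using h unfolding E'_def E_def mem_Collect_eq sum right_diff_distrib sum_subtractf by linarith
      finally show False using r by simp
    qed
    have "measure_pmf.prob (Pi_pmf G d p) E' \<le> q ^ m"
    proof (cases "E' = {}")
      case True
      \<comment> \<open>For the empty event \<open>q ^ m\<close> must be nonnegative: for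
        \<open>m = 0\<close> it is 1, otherwise \<open>q\<close> bounds some point
        probability.\<close>
      have "q \<ge> 0" if "m \<noteq> 0"
      proof -
        have "g 0 \<in> J" using that g by auto
        then show ?thesis using q[of "g 0" True] pmf_nonneg[of "p (g 0)" True] by linarith
      qed
      then show ?thesis using True by (cases "m = 0") auto
    next
      case False
      then obtain h0 where h0: "h0 \<in> E'" by blast
      have "measure_pmf.prob (Pi_pmf G d p) E' \<le> measure_pmf.prob (Pi_pmf G d p) (Pi G (\<lambda>x. {h0 x}))"
        using agree[OF _ h0] by (intro measure_pmf.finite_measure_mono) auto
      also have "\<dots> = (\<Prod>x\<in>G. measure_pmf.prob (p x) {h0 x})"
        using G by (intro measure_Pi_pmf_Pi) auto
      also have "\<dots> \<le> (\<Prod>x\<in>G. q)"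
        using q G by (intro prod_mono) (auto simp: measure_pmf_single)
      finally show ?thesis using G by simp
    qed
    then show "measure_pmf.prob (map_pmf (\<lambda>h x. if x \<in> J - G then f x else h x) (Pi_pmf G d p)) E \<le> q ^ m"
      unfolding E'_def by (simp add: vimage_def)
  qed
  then show ?thesis unfolding E_def .
qed

section \<open>The critical index of a row\<close>

text \<open>As \<open>prec_idx\<close> is a strict total order, counting predecessors is injective
  and hence permutes \<open>{..<n}\<close>; \<open>e\<close> is the inverse permutation. Positions
  count from 0 here, which explains \<open>real a + 1\<close>.\<close>

lemma prec_idx_enumeration:
  obtains e where "bij_betw e {..<n} {..<n}"
    "\<And>a b. a \<le> b \<Longrightarrow> b < n \<Longrightarrow> \<bar>u (e b)\<bar> \<le> \<bar>u (e a)\<bar>"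
    "\<And>t. top_idx t n u = e ` {a. a < n \<and> real a + 1 \<le> t}"
proof -
  define rk where "rk j = card {j'. j' < n \<and> prec_idx u j' j}" for j
  have trans: "prec_idx u a c" if "prec_idx u a b" "prec_idx u b c" for a b c
    using that unfolding prec_idx_def by auto
  have irrefl: "\<not> prec_idx u a a" for a unfolding prec_idx_def by auto
  have total: "prec_idx u a b \<or> prec_idx u b a" if "a \<noteq> b" for a b
    using that unfolding prec_idx_def by auto
  have rk_less: "rk a < rk b" if "prec_idx u a b" "a < n" for a b
  proof -
    have "{j'. j' < n \<and> prec_idx u j' a} \<subseteq> {j'. j' < n \<and> prec_idx u j' b}" using that trans by blast
    moreover have "a \<in> {j'. j' < n \<and> prec_idx u j' b}" "a \<notin> {j'. j' < n \<and> prec_idx u j' a}"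
      using that irrefl by auto
    ultimately show ?thesis unfolding rk_def by (intro psubset_card_mono) auto
  qed
  have "inj_on rk {..<n}"
    by (rule inj_onI) (metis rk_less total lessThan_iff less_irrefl_nat)
  moreover have "rk j < n" if "j < n" for j
  proof -
    have "{j'. j' < n \<and> prec_idx u j' j} \<subset> {..<n}" using that irrefl by auto
    then have "rk j < card {..<n}" unfolding rk_def by (intro psubset_card_mono) auto
    then show ?thesis by simp
  qed
  ultimately have bij: "bij_betw rk {..<n} {..<n}"
    unfolding bij_betw_def using endo_inj_surj[of "{..<n}" rk] by blast
  define e where "e = inv_into {..<n} rk"
  have bije: "bij_betw e {..<n} {..<n}" unfolding e_def using bij by (rule bij_betw_inv_into)
  have rke: "rk (e a) = a" "e a < n" if "a < n" for a
    using that bij bij_betwE[OF bije] unfolding e_def by (auto simp: bij_betw_inv_into_right)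
  have "\<bar>u (e b)\<bar> \<le> \<bar>u (e a)\<bar>" if "a \<le> b" "b < n" for a b
  proof (rule ccontr)
    assume "\<not> ?thesis"
    then have "prec_idx u (e b) (e a)" unfolding prec_idx_def by auto
    then have "rk (e b) < rk (e a)" using rk_less rke that by blast
    then show False using rke that by auto
  qed
  moreover have "top_idx t n u = e ` {a. a < n \<and> real a + 1 \<le> t}" for t
  proof -
    have "j \<in> e ` {a. a < n \<and> real a + 1 \<le> t}" if "j < n" "real (rk j) + 1 \<le> t" for j
    proof -
      have "j \<in> e ` {..<n}" using that(1) bij_betw_imp_surj_on[OF bije] by simp
      then obtain a where "a < n" "j = e a" by blast
      then show ?thesis using that rke by auto
    qed
    then show ?thesis unfolding top_idx_def rk_def[symmetric] using rke by auto
  qed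
  ultimately show thesis using that bije by blast
qed

text \<open>Meant for \<open>S\<close> the tail energy and \<open>c = \<tau>\<^sup>2\<close>: every
  position removes a fixed fraction of the energy, and \<open>1 - c \<le> exp (- c)\<close> turns
  this into exponential decay.\<close>

lemma critical_index_decay:
  fixes S :: "nat \<Rightarrow> real" and c :: real
  assumes step: "\<And>l. l < N \<Longrightarrow> S (Suc l) \<le> (1 - c) * S l" and nonneg: "\<And>l. S l \<ge> 0"
    and "l + m \<le> N"
  shows "S (l + m) \<le> exp (- c * real m) * S l"
  using assms(3)
proof (induction m)
  case (Suc m)
  have "S (l + Suc m) \<le> (1 - c) * S (l + m)" using step[of "l + m"] Suc.prems by simp
  also have "\<dots> \<le> exp (- c) * S (l + m)"
    using exp_ge_add_one_self[of "- c"] nonneg by (intro mult_right_mono) auto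
  also have "\<dots> \<le> exp (- c) * (exp (- c * real m) * S l)"
    using Suc by (intro mult_left_mono) auto
  also have "\<dots> = exp (- c * real (Suc m)) * S l"
    by (simp add: algebra_simps flip: exp_add)
  finally show ?case .
qed simp

text \<open>Either the sorted row has its critical index among the first \<open>t\<close> positions, or the energy of its
  tails decays so fast over these positions that they contain \<open>m\<close> geometrically decreasing
  coefficients dominating everything after position \<open>t\<close>.\<close>

lemma critical_index_dichotomy:
  fixes u :: "nat \<Rightarrow> real" and t \<tau> s :: real and m T n :: nat
  assumes \<tau>: "0 < \<tau>" "\<tau> \<le> 1/25" and mT: "m \<ge> 1" "T \<ge> 1" and s: "s \<ge> 0"
    and expT: "exp (- (\<tau>\<^sup>2 * real T)) \<le> \<tau> ^ 4"
    and exps: "exp (- (\<tau>\<^sup>2 * s)) * real n \<le> \<tau> ^ 3"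
    and t: "t = s + real (m * T)"
  obtains H where "H \<subseteq> top_idx t n u"
      "\<And>j. j \<in> {..<n} - H \<Longrightarrow> (u j)\<^sup>2 \<le> \<tau>\<^sup>2 * (\<Sum>j\<in>{..<n} - H. (u j)\<^sup>2)"
  | g where "inj_on g {..<m}" "g ` {..<m} \<subseteq> top_idx t n u"
      "\<And>a. Suc a < m \<Longrightarrow> \<bar>u (g (Suc a))\<bar> \<le> \<bar>u (g a)\<bar> / 3"
      "u (g (m - 1)) \<noteq> 0"
      "(\<Sum>j\<in>{..<n} - top_idx t n u. \<bar>u j\<bar>) \<le> \<bar>u (g (m - 1))\<bar> / 5"
proof -
  obtain e where bij: "bij_betw e {..<n} {..<n}"
    and mono: "\<And>a b. a \<le> b \<Longrightarrow> b < n \<Longrightarrow> \<bar>u (e b)\<bar> \<le> \<bar>u (e a)\<bar>"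
    and top: "\<And>t. top_idx t n u = e ` {a. a < n \<and> real a + 1 \<le> t}"
    using prec_idx_enumeration[of n u] by blast
  have inj: "inj_on e {..<n}" and img: "e ` {..<n} = {..<n}" using bij unfolding bij_betw_def by auto
  define S where "S l = (\<Sum>b\<in>{l..<n}. (u (e b))\<^sup>2)" for l
  have Snn: "S l \<ge> 0" for l unfolding S_def by (intro sum_nonneg) auto
  have compl: "{..<n} - e ` {..<l} = e ` {l..<n}" if "l \<le> n" for l
  proof -
    have "e ` {..<n} - e ` {..<l} = e ` ({..<n} - {..<l})"
      using that inj by (intro inj_on_image_set_diff[symmetric]) auto
    also have "{..<n} - {..<l} = {l..<n}" using that by auto
    finally show ?thesis using img by simp
  qed
  have sum_tail: "(\<Sum>j\<in>e ` {l..<n}. f j) = (\<Sum>b\<in>{l..<n}. f (e b))" for l and f :: "nat \<Rightarrow> real"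
    using inj by (subst sum.reindex) (auto intro: inj_on_subset)
  \<comment> \<open>A 0-based position \<open>a < n\<close> belongs to \<open>top_idx\<close> iff
    \<open>a < N\<close>.\<close>
  define N where "N = nat \<lfloor>t\<rfloor>"
  have "1 \<le> m * T" using mT by simp
  then have "1 \<le> real (m * T)" by (simp only: real_of_nat_ge_one_iff)
  then have tpos: "t \<ge> 1" using s unfolding t by linarith
  have N_iff: "real a \<le> t \<longleftrightarrow> a \<le> N" for a
    unfolding N_def using tpos by linarith
  have N_iff': "real a + 1 \<le> t \<longleftrightarrow> a < N" for a
    using N_iff[of "Suc a"] by (simp add: Suc_le_eq add.commute)
  show thesis
  \<comment> \<open>Search for the critical index: either the row is exhausted, or the largest
    remaining coefficient is small against its own tail.\<close>
  proof (cases "\<exists>l\<le>N. n \<le> l \<or> (u (e l))\<^sup>2 \<le> \<tau>\<^sup>2 * S l")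
    case True
    then obtain l where l: "l \<le> N" "n \<le> l \<or> (u (e l))\<^sup>2 \<le> \<tau>\<^sup>2 * S l" by blast
    show thesis
    proof (cases "n \<le> l")
      case True
      have "top_idx t n u = e ` {..<n}" unfolding top N_iff' using True l by auto
      then show thesis using img by (intro that(1)[of "{..<n}"]) auto
    next
      case False
      then have l': "(u (e l))\<^sup>2 \<le> \<tau>\<^sup>2 * S l" "l < n" using l by auto
      show thesis
      proof (rule that(1)[of "e ` {..<l}"])
        show "e ` {..<l} \<subseteq> top_idx t n u" unfolding top N_iff' using l l' by auto
        fix j assume "j \<in> {..<n} - e ` {..<l}"
        then obtain b where b: "b \<in> {l..<n}" "j = e b" using compl[of l] l' by auto
        \<comment> \<open>The row is sorted, so the bound at position \<open>l\<close> covers the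
          whole tail.\<close>
        have "(u j)\<^sup>2 \<le> (u (e l))\<^sup>2" using mono[of l b] b by (simp add: abs_le_square_iff)
        also have "\<dots> \<le> \<tau>\<^sup>2 * S l" by (rule l')
        also have "S l = (\<Sum>j\<in>{..<n} - e ` {..<l}. (u j)\<^sup>2)"
          unfolding compl[OF less_imp_le[OF l'(2)]] sum_tail S_def ..
        finally show "(u j)\<^sup>2 \<le> \<tau>\<^sup>2 * (\<Sum>j\<in>{..<n} - e ` {..<l}. (u j)\<^sup>2)" .
      qed
    qed
  next
    case False
    then have big: "l < n" "\<tau>\<^sup>2 * S l < (u (e l))\<^sup>2" if "l \<le> N" for l
      using that by (meson not_le)+
    have Ssuc: "S l = (u (e l))\<^sup>2 + S (Suc l)" if "l \<le> N" for l
      unfolding S_def using big(1)[OF that] by (simp add: sum.atLeast_Suc_lessThan)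
    \<comment> \<open>Without regularity, each position removes more than the fraction
      \<open>\<tau>\<^sup>2\<close> of the remaining energy.\<close>
    have decay: "S (l + r) \<le> exp (- (\<tau>\<^sup>2) * real r) * S l" if "l + r \<le> N" for l r
    proof (rule critical_index_decay[where N = N])
      show "S (Suc l) \<le> (1 - \<tau>\<^sup>2) * S l" if "l < N" for l
        using Ssuc[of l] big(2)[of l] that by (simp add: algebra_simps)
    qed (use Snn that in auto)
    \<comment> \<open>Over \<open>T\<close> positions the energy shrinks by
      \<open>\<tau> ^ 4\<close>: one factor \<open>\<tau>\<^sup>2\<close> turns the energy at
      \<open>l\<close> back into the coefficient there, the other gives the ratio, since
      \<open>\<tau> \<le> 1/3\<close>.\<close>
    have jump: "\<bar>u (e (l + T))\<bar> \<le> \<bar>u (e l)\<bar> / 3" if "l + T \<le> N" for l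
    proof -
      have "(u (e (l + T)))\<^sup>2 \<le> S (l + T)" using Ssuc[OF that] Snn[of "Suc (l + T)"] by simp
      also have "\<dots> \<le> exp (- (\<tau>\<^sup>2) * real T) * S l" by (rule decay[OF that])
      also have "\<dots> \<le> \<tau>^4 * S l" using expT Snn by (intro mult_right_mono) auto
      also have "\<dots> = \<tau>\<^sup>2 * (\<tau>\<^sup>2 * S l)" by (simp add: power_add[symmetric] mult.assoc[symmetric])
      also have "\<dots> \<le> \<tau>\<^sup>2 * (u (e l))\<^sup>2" using big(2)[of l] that by (intro mult_left_mono) auto
      also have "\<dots> \<le> (1/3)\<^sup>2 * (u (e l))\<^sup>2" using \<tau> by (intro mult_right_mono power_mono) auto
      also have "\<dots> = (\<bar>u (e l)\<bar> / 3)\<^sup>2" by (simp add: power_divide)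
      finally have "\<bar>u (e (l + T))\<bar>\<^sup>2 \<le> (\<bar>u (e l)\<bar> / 3)\<^sup>2" by simp
      then show ?thesis by (rule power2_le_imp_le) simp
    qed
    define l0 where "l0 = (m - 1) * T"
    have l0T: "l0 + T = m * T" unfolding l0_def using mT by (cases m) auto
    have mTN: "m * T \<le> N" using N_iff[of "m * T"] s unfolding t by simp
    have aT: "a * T + T \<le> m * T" if "a < m" for a
      using that mult_le_mono1[of "Suc a" m T] by simp
    show thesis
    proof (rule that(2)[of "\<lambda>a. e (a * T)"])
      have lt: "a * T < n" "a * T < N" if "a < m" for a
        using aT[OF that] mTN mT big(1)[of "a * T"] by auto
      show "inj_on (\<lambda>a. e (a * T)) {..<m}"
        using lt mT inj by (intro inj_onI) (auto dest!: inj_onD[OF inj])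
      show "(\<lambda>a. e (a * T)) ` {..<m} \<subseteq> top_idx t n u"
        unfolding top N_iff' using lt by auto
      show "\<bar>u (e (Suc a * T))\<bar> \<le> \<bar>u (e (a * T))\<bar> / 3" if "Suc a < m" for a
        using jump[of "a * T"] aT[of a] mTN that by (simp add: add.commute)
      have l0: "l0 \<le> N" using l0T mTN by simp
      have "0 \<le> \<tau>\<^sup>2 * S l0" using Snn by simp
      then have "(u (e l0))\<^sup>2 > 0" using big(2)[OF l0] by linarith
      then show "u (e ((m - 1) * T)) \<noteq> 0" unfolding l0_def by simp
      have "top_idx t n u = e ` {..<N}" unfolding top N_iff' using big(1)[of N] by auto
      then have "{..<n} - top_idx t n u = e ` {N..<n}" using compl[of N] big(1)[of N] by simp
      then have L1: "(\<Sum>j\<in>{..<n} - top_idx t n u. \<bar>u j\<bar>) = (\<Sum>b\<in>{N..<n}. \<bar>u (e b)\<bar>)"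
        by (simp add: sum_tail)
      \<comment> \<open>Cauchy-Schwarz passes to the energy at the cost of a factor
        \<open>n\<close>, which \<open>exps\<close> pays for through the decay over at least
        \<open>s\<close> positions after \<open>l0\<close>.\<close>
      have "(\<Sum>b\<in>{N..<n}. \<bar>u (e b)\<bar>)\<^sup>2 \<le> real (card {N..<n}) * (\<Sum>b\<in>{N..<n}. \<bar>u (e b)\<bar>\<^sup>2)"
        using sum_squared_le_sum_of_squares[of "\<lambda>b. \<bar>u (e b)\<bar>" "{N..<n}"] by (simp add: mult_ac)
      also have "\<dots> \<le> real n * S N" unfolding S_def power2_abs
        by (intro mult_right_mono sum_nonneg) auto
      also have "\<dots> \<le> real n * (exp (- (\<tau>\<^sup>2 * s)) * S l0)"
      proof (intro mult_left_mono)
        \<comment> \<open>Rounding \<open>t\<close> down loses less than one position, and the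
          \<open>T \<ge> 1\<close> positions from \<open>l0\<close> to \<open>m * T\<close> make up
          for it.\<close>
        have "real (N - l0) \<ge> s"
        proof -
          have "t < real N + 1" unfolding N_def using tpos by linarith
          moreover have "real (m * T) = real l0 + real T" using l0T by (metis of_nat_add)
          ultimately show ?thesis using l0 mT unfolding t by (simp add: of_nat_diff)
        qed
        then have "exp (- (\<tau>\<^sup>2) * real (N - l0)) \<le> exp (- (\<tau>\<^sup>2 * s))"
          by (simp add: mult_left_mono)
        then have "exp (- (\<tau>\<^sup>2) * real (N - l0)) * S l0 \<le> exp (- (\<tau>\<^sup>2 * s)) * S l0"
          using Snn by (intro mult_right_mono) auto
        then show "S N \<le> exp (- (\<tau>\<^sup>2 * s)) * S l0"
          using decay[of l0 "N - l0"] l0 by simp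
      qed simp
      also have "\<dots> \<le> \<tau> ^ 3 * S l0"
        using mult_right_mono[OF exps Snn[of l0]] by (simp add: mult_ac)
      also have "\<dots> = \<tau> * (\<tau>\<^sup>2 * S l0)" by (simp add: power2_eq_square power3_eq_cube)
      also have "\<dots> \<le> \<tau> * (u (e l0))\<^sup>2" using big(2)[OF l0] \<tau> by (intro mult_left_mono) auto
      also have "\<dots> \<le> (1/25) * (u (e l0))\<^sup>2" using \<tau> by (intro mult_right_mono) auto
      also have "\<dots> = (\<bar>u (e l0)\<bar> / 5)\<^sup>2" by (simp add: power_divide)
      finally show "(\<Sum>j\<in>{..<n} - top_idx t n u. \<bar>u j\<bar>) \<le> \<bar>u (e ((m - 1) * T))\<bar> / 5"
        unfolding L1 l0_def by (rule power2_le_imp_le) simp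
    qed
  qed
qed

section \<open>Exchanging columns\<close>

text \<open>The columns are exchanged one at a time; translation invariance of the one-column hypothesis
  absorbs the remaining columns.\<close>

lemma lindeberg_exchange:
  fixes L :: "'a \<Rightarrow> 'b \<Rightarrow> real" and \<Psi> :: "real \<Rightarrow> real"
  assumes "finite A" and fin: "finite (set_pmf Q0)" "finite (set_pmf Q1)"
    and one: "\<And>j c. j \<in> A \<Longrightarrow> \<bar>measure_pmf.expectation Q1 (\<lambda>y. \<Psi> (c + L j y)) -
      measure_pmf.expectation Q0 (\<lambda>y. \<Psi> (c + L j y))\<bar> \<le> \<epsilon> j"
  shows "\<bar>measure_pmf.expectation (Pi_pmf A d (\<lambda>_. Q1)) (\<lambda>Y. \<Psi> (c + (\<Sum>j\<in>A. L j (Y j)))) -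
      measure_pmf.expectation (Pi_pmf A d (\<lambda>_. Q0)) (\<lambda>Y. \<Psi> (c + (\<Sum>j\<in>A. L j (Y j))))\<bar> \<le> (\<Sum>j\<in>A. \<epsilon> j)"
  using assms(1) one
proof (induction A arbitrary: c rule: finite_induct)
  case (insert x A)
  define P0 P1 where "P0 = Pi_pmf A d (\<lambda>_. Q0)" and "P1 = Pi_pmf A d (\<lambda>_. Q1)"
  have finP: "finite (set_pmf P0)" "finite (set_pmf P1)"
    unfolding P0_def P1_def using insert.hyps fin by (auto intro!: finite_set_Pi_pmf)
  define F where "F y f = \<Psi> ((c + L x y) + (\<Sum>j\<in>A. L j (f j)))" for y f
  have upd: "(\<lambda>f. \<Psi> (c + (\<Sum>j\<in>insert x A. L j ((f(x := y)) j)))) = F y" for y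
  proof
    fix f
    have "(\<Sum>j\<in>insert x A. L j ((f(x := y)) j)) = L x y + (\<Sum>j\<in>A. L j (f j))"
      using insert.hyps by (auto intro!: sum.cong)
    then show "\<Psi> (c + (\<Sum>j\<in>insert x A. L j ((f(x := y)) j))) = F y f"
      unfolding F_def by (simp only: add.assoc)
  qed
  have E1: "measure_pmf.expectation (Pi_pmf (insert x A) d (\<lambda>_. Q1)) (\<lambda>Y. \<Psi> (c + (\<Sum>j\<in>insert x A. L j (Y j)))) =
      measure_pmf.expectation Q1 (\<lambda>y. measure_pmf.expectation P1 (F y))"
    using insert.hyps fin by (subst expectation_Pi_pmf_insert) (auto simp only: upd P1_def)
  have E0: "measure_pmf.expectation (Pi_pmf (insert x A) d (\<lambda>_. Q0)) (\<lambda>Y. \<Psi> (c + (\<Sum>j\<in>insert x A. L j (Y j)))) =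
      measure_pmf.expectation Q0 (\<lambda>y. measure_pmf.expectation P0 (F y))"
    using insert.hyps fin by (subst expectation_Pi_pmf_insert) (auto simp only: upd P0_def)
  \<comment> \<open>The hybrid has \<open>Q0\<close> in column \<open>x\<close> and
    \<open>Q1\<close> in all others. This bound compares it with all columns from \<open>Q1\<close>;
    the next one, by induction with column \<open>x\<close> absorbed into the shift, compares it
    with all columns from \<open>Q0\<close>.\<close>
  have "\<bar>measure_pmf.expectation P1 (\<lambda>f. measure_pmf.expectation Q1 (\<lambda>y. F y f)) -
      measure_pmf.expectation P1 (\<lambda>f. measure_pmf.expectation Q0 (\<lambda>y. F y f))\<bar> \<le> \<epsilon> x"
  proof (rule abs_expectation_diff_le[OF finP(2)])
    fix f
    show "\<bar>measure_pmf.expectation Q1 (\<lambda>y. F y f) - measure_pmf.expectation Q0 (\<lambda>y. F y f)\<bar> \<le> \<epsilon> x"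
      using insert.prems[of x "c + (\<Sum>j\<in>A. L j (f j))"] unfolding F_def by (simp add: add_ac)
  qed
  moreover have "\<bar>measure_pmf.expectation Q0 (\<lambda>y. measure_pmf.expectation P1 (F y)) -
      measure_pmf.expectation Q0 (\<lambda>y. measure_pmf.expectation P0 (F y))\<bar> \<le> (\<Sum>j\<in>A. \<epsilon> j)"
    using insert.IH insert.prems unfolding F_def P0_def P1_def
    by (intro abs_expectation_diff_le[OF fin(1)]) auto
  ultimately show ?case
    unfolding E0 E1 using insert.hyps
    by (simp add: expectation_swap_finite[OF fin(1) finP(2)] expectation_swap_finite[OF fin(2) finP(2)])
qed simp

text \<open>The distribution function of a sum of four independent uniform variables on \<open>[0, l]\<close>: a
  step function of class \<open>C\<^sup>3\<close> whose third-order Taylor remainder is elementary.\<close>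

definition pos4 :: "real \<Rightarrow> real" where "pos4 x = (max x 0) ^ 4"

definition spline_step :: "real \<Rightarrow> real \<Rightarrow> real" where
  "spline_step l s = (pos4 s - 4 * pos4 (s - l) + 6 * pos4 (s - 2 * l) - 4 * pos4 (s - 3 * l)
     + pos4 (s - 4 * l)) / (24 * l ^ 4)"

text \<open>The polynomial is the cubic Taylor expansion at \<open>s\<close>. If \<open>s\<close>
  and \<open>s + z\<close> lie on the same side of 0, the remainder is \<open>z ^ 4\<close> or 0; if
  0 is crossed, \<open>\<bar>s + z\<bar> \<le> \<bar>z\<bar>\<close> bounds it.\<close>

lemma pos4_taylor:
  "\<bar>pos4 (s + z) - (max s 0 ^ 4 + 4 * max s 0 ^ 3 * z + 6 * max s 0 ^ 2 * z ^ 2 + 4 * max s 0 * z ^ 3)\<bar> \<le> z ^ 4"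
proof -
  have binom: "(s + z) ^ 4 = s ^ 4 + 4 * s ^ 3 * z + 6 * s ^ 2 * z ^ 2 + 4 * s * z ^ 3 + z ^ 4"
    by algebra
  consider "s \<ge> 0" "s + z \<ge> 0" | "s \<ge> 0" "s + z < 0" | "s < 0" "s + z \<ge> 0" | "s < 0" "s + z < 0"
    by linarith
  then show ?thesis
  proof cases
    case 1
    then show ?thesis unfolding pos4_def by (simp add: max_def binom)
  next
    case 2
    have "\<bar>s + z\<bar> ^ 4 \<le> \<bar>z\<bar> ^ 4" using 2 by (intro power_mono) auto
    then have "(s + z) ^ 4 \<le> z ^ 4" "0 \<le> (s + z) ^ 4" by simp_all
    then show ?thesis using 2 binom unfolding pos4_def by (simp add: max_def)
  next
    case 3
    have "(s + z) ^ 4 \<le> z ^ 4" using 3 by (intro power_mono) auto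
    then show ?thesis using 3 unfolding pos4_def by (simp add: max_def)
  next
    case 4
    then show ?thesis unfolding pos4_def by (simp add: max_def)
  qed
qed

text \<open>Each of the five truncated quartics contributes a remainder of at most
  \<open>z ^ 4\<close>; their absolute weights add up to 16, below the normalisation 24.\<close>

lemma spline_step_taylor:
  assumes l: "l > 0"
  shows "\<exists>c. \<forall>z. \<bar>spline_step l (s + z) - (\<Sum>m\<le>(3::nat). c m * z ^ m)\<bar> \<le> z ^ 4 / l ^ 4"
proof -
  define p where "p i = max (s - real i * l) 0" for i :: nat
  define T where "T i z = p i ^ 4 + 4 * p i ^ 3 * z + 6 * p i ^ 2 * z ^ 2 + 4 * p i * z ^ 3" for i z
  define a where "a m = real (4 choose m) * (p 0 ^ (4 - m) - 4 * p 1 ^ (4 - m) + 6 * p 2 ^ (4 - m)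
    - 4 * p 3 ^ (4 - m) + p 4 ^ (4 - m))" for m
  have rem: "\<bar>pos4 (s + z - real i * l) - T i z\<bar> \<le> z ^ 4" for i z
    using pos4_taylor[of "s - real i * l" z] unfolding T_def p_def by (simp add: algebra_simps)
  show ?thesis
  proof (intro exI[of _ "\<lambda>m. a m / (24 * l ^ 4)"] allI)
    fix z
    define D where "D i = pos4 (s + z - real i * l) - T i z" for i
    have bin: "4 choose 0 = (1::nat)" "4 choose 1 = (4::nat)" "4 choose 2 = (6::nat)" "4 choose 3 = (4::nat)"
      by (simp_all add: eval_nat_numeral)
    have "(\<Sum>m\<le>(3::nat). a m / (24 * l ^ 4) * z ^ m) = (a 0 + a 1 * z + a 2 * z ^ 2 + a 3 * z ^ 3) / (24 * l ^ 4)"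
      by (simp add: eval_nat_numeral add_divide_distrib)
    also have "a 0 + a 1 * z + a 2 * z ^ 2 + a 3 * z ^ 3 = T 0 z - 4 * T 1 z + 6 * T 2 z - 4 * T 3 z + T 4 z"
      unfolding a_def T_def bin by (simp add: algebra_simps)
    finally have "spline_step l (s + z) - (\<Sum>m\<le>(3::nat). a m / (24 * l ^ 4) * z ^ m) =
        (D 0 - 4 * D 1 + 6 * D 2 - 4 * D 3 + D 4) / (24 * l ^ 4)"
      unfolding spline_step_def D_def by (simp add: diff_divide_distrib add_divide_distrib)
    also have "\<bar>\<dots>\<bar> = \<bar>D 0 - 4 * D 1 + 6 * D 2 - 4 * D 3 + D 4\<bar> / (24 * l ^ 4)"
      using l by (simp add: abs_divide)
    also have "\<dots> \<le> (24 * z ^ 4) / (24 * l ^ 4)"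
    proof (rule divide_right_mono)
      have z4: "0 \<le> z ^ 4" by simp
      have "\<bar>D i\<bar> \<le> z ^ 4" for i unfolding D_def by (rule rem)
      from this[of 0] this[of 1] this[of 2] this[of 3] this[of 4] z4
      show "\<bar>D 0 - 4 * D 1 + 6 * D 2 - 4 * D 3 + D 4\<bar> \<le> 24 * z ^ 4" by linarith
    qed (use l in simp)
    finally show "\<bar>spline_step l (s + z) - (\<Sum>m\<le>(3::nat). a m / (24 * l ^ 4) * z ^ m)\<bar> \<le> z ^ 4 / l ^ 4" by simp
  qed
qed

lemma spline_step_eq_0: "l > 0 \<Longrightarrow> s \<le> 0 \<Longrightarrow> spline_step l s = 0"
  unfolding spline_step_def pos4_def by (simp add: max_def)

text \<open>Beyond the last knot no term is truncated, and the fourth finite difference of the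
  fourth power with step \<open>l\<close> is \<open>24 * l ^ 4\<close>.\<close>

lemma spline_step_eq_1:
  assumes "l > 0" "s \<ge> 4 * l"
  shows "spline_step l s = 1"
proof -
  have "s ^ 4 - 4 * (s - l) ^ 4 + 6 * (s - 2 * l) ^ 4 - 4 * (s - 3 * l) ^ 4 + (s - 4 * l) ^ 4 = 24 * l ^ 4"
    by algebra
  then show ?thesis using assms unfolding spline_step_def pos4_def by (simp add: max_def)
qed

text \<open>A crude bound: each truncated power is at most \<open>256 * l ^ 4\<close>, the absolute
  weights add up to 16, and \<open>16 * 256 / 24 < 171\<close>.\<close>

lemma abs_spline_step_le:
  assumes l: "l > 0" and s: "0 \<le> s" "s \<le> 4 * l"
  shows "\<bar>spline_step l s\<bar> \<le> 171"
proof -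
  have b: "0 \<le> pos4 (s - i * l) \<and> pos4 (s - i * l) \<le> 256 * l ^ 4" if "i \<ge> 0" for i
  proof -
    have "0 \<le> i * l" using that l by simp
    then have "max (s - i * l) 0 \<le> 4 * l" using s l by auto
    then have "max (s - i * l) 0 ^ 4 \<le> (4 * l) ^ 4" by (intro power_mono) auto
    then show ?thesis unfolding pos4_def by (simp add: power_mult_distrib)
  qed
  have "\<bar>pos4 s - 4 * pos4 (s - l) + 6 * pos4 (s - 2 * l) - 4 * pos4 (s - 3 * l) + pos4 (s - 4 * l)\<bar> \<le> 171 * (24 * l ^ 4)"
    using b[of 0] b[of 1] b[of 2] b[of 3] b[of 4] by simp linarith
  then show ?thesis unfolding spline_step_def using l by (simp add: abs_divide divide_le_eq)
qed

section \<open>The noisy matrix\<close>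

text \<open>Bits are idempotent, so a moment depends only on the support of the multiset.\<close>

lemma prod_mset_of_bool:
  "(\<Prod>i\<in>#S. (of_bool (P i) :: real)) = (\<Prod>i\<in>set_mset S. of_bool (P i))"
proof (induction S)
  case (add x S)
  then show ?case
    by (cases "x \<in># S") (auto simp: insert_absorb prod.remove[of "set_mset S" x])
qed simp

definition same_moments :: "nat \<Rightarrow> (nat \<Rightarrow> bool) pmf \<Rightarrow> (nat \<Rightarrow> bool) pmf \<Rightarrow> bool" where
  "same_moments k P Q \<longleftrightarrow> (\<forall>S. set_mset S \<subseteq> {..<k} \<and> size S \<le> 4 \<longrightarrow>
     measure_pmf.expectation P (\<lambda>x. \<Prod>i\<in>#S. (of_bool (x i) :: real)) =
     measure_pmf.expectation Q (\<lambda>x. \<Prod>i\<in>#S. (of_bool (x i) :: real)))"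

definition noisy :: "nat \<Rightarrow> (nat \<Rightarrow> bool) pmf \<Rightarrow> (nat \<Rightarrow> bool) pmf" where
  "noisy k D = bind_pmf D (\<lambda>x. Pi_pmf {..<k} False (\<lambda>i. noise_pmf k (x i)))"

text \<open>The law of the queried point once the bit of the test is fixed.\<close>

definition noisy_matrix :: "nat \<Rightarrow> nat \<Rightarrow> (nat \<Rightarrow> bool) pmf \<Rightarrow> (nat \<times> nat \<Rightarrow> bool) pmf" where
  "noisy_matrix k R D = bind_pmf (Pi_pmf {..<R} (\<lambda>_. False) (\<lambda>_. D))
     (\<lambda>X. Pi_pmf ({..<k} \<times> {..<R}) False (\<lambda>(i,j). noise_pmf k (X j i)))"

lemma pmf_noise:
  assumes "k \<ge> 1"
  shows "pmf (noise_pmf k b) True = (1 - 1 / (real k)\<^sup>2) * of_bool b + 1 / (2 * (real k)\<^sup>2)"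
    and "pmf (noise_pmf k b) False = (1 - 1 / (real k)\<^sup>2) * of_bool (\<not> b) + 1 / (2 * (real k)\<^sup>2)"
proof -
  have "1 / (real k)\<^sup>2 \<le> 1" using assms by (auto simp: divide_le_eq_1)
  then show "pmf (noise_pmf k b) True = (1 - 1 / (real k)\<^sup>2) * of_bool b + 1 / (2 * (real k)\<^sup>2)"
    "pmf (noise_pmf k b) False = (1 - 1 / (real k)\<^sup>2) * of_bool (\<not> b) + 1 / (2 * (real k)\<^sup>2)"
    unfolding noise_pmf_def pmf_bind expectation_bool_pmf by auto
qed

text \<open>With \<open>\<delta> = 1 / (2 * (real k)\<^sup>2)\<close> the two outcomes have
  probabilities \<open>\<delta>\<close> and \<open>1 - \<delta>\<close>. The first bound makes every
  long bit pattern unlikely; the second is a lower bound for the variance of an entry.\<close>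

lemma noise_bounds:
  assumes "k \<ge> 2"
  shows "pmf (noise_pmf k b) c \<le> 1 - 1 / (2 * (real k)\<^sup>2)"
    and "1 / (4 * (real k)\<^sup>2) \<le> pmf (noise_pmf k b) True * pmf (noise_pmf k b) False"
proof -
  define \<delta> where "\<delta> = 1 / (2 * (real k)\<^sup>2)"
  have "(2::real)\<^sup>2 \<le> (real k)\<^sup>2" using assms by (intro power_mono) auto
  then have \<delta>: "0 \<le> \<delta>" "\<delta> \<le> 1/2" unfolding \<delta>_def by (auto simp: divide_simps)
  have eq: "1 / (real k)\<^sup>2 = 2 * \<delta>" "1 / (4 * (real k)\<^sup>2) = \<delta> / 2" unfolding \<delta>_def by auto
  have T: "pmf (noise_pmf k b) True = (1 - 2 * \<delta>) * of_bool b + \<delta>"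
    and F: "pmf (noise_pmf k b) False = (1 - 2 * \<delta>) * of_bool (\<not> b) + \<delta>"
    using pmf_noise[of k b] assms unfolding eq \<delta>_def[symmetric] by auto
  show "pmf (noise_pmf k b) c \<le> 1 - 1 / (2 * (real k)\<^sup>2)"
    unfolding \<delta>_def[symmetric] using \<delta> T F by (cases b; cases c) auto
  have "\<delta> * (1/2) \<le> \<delta> * (1 - \<delta>)" using \<delta> by (intro mult_left_mono) auto
  then show "1 / (4 * (real k)\<^sup>2) \<le> pmf (noise_pmf k b) True * pmf (noise_pmf k b) False"
    unfolding eq T F by (cases b) (auto simp: algebra_simps)
qed

lemma finite_set_noisy:
  assumes "finite (set_pmf D)"
  shows "finite (set_pmf (noisy k D))"
  unfolding noisy_def using assms by (auto intro!: finite_set_Pi_pmf)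

text \<open>Given the clean column, the expectation of each noisy bit is an affine function of the
  clean bit. Expanding the product of at most four of them leaves only moments over subsets, which
  agree.\<close>

lemma same_moments_noisy:
  assumes k: "k \<ge> 1" and fin: "finite (set_pmf D0)" "finite (set_pmf D1)"
    and mom: "same_moments k D0 D1"
  shows "same_moments k (noisy k D0) (noisy k D1)"
  unfolding same_moments_def
proof (intro allI impI)
  fix S :: "nat multiset" assume S: "set_mset S \<subseteq> {..<k} \<and> size S \<le> 4"
  define A where "A = set_mset S"
  define a b where "a = 1 - 1 / (real k)\<^sup>2" and "b = 1 / (2 * (real k)\<^sup>2)"
  have "card (set_mset S) \<le> size S"
    by (induction S) (auto intro: order_trans[OF card_insert_le_m1] simp: card_insert_if)
  then have A: "finite A" "A \<subseteq> {..<k}" "card A \<le> 4"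
    using S unfolding A_def by auto
  have sub: "measure_pmf.expectation D0 (\<lambda>x. \<Prod>i\<in>X. (of_bool (x i) :: real)) =
      measure_pmf.expectation D1 (\<lambda>x. \<Prod>i\<in>X. (of_bool (x i) :: real))" if "X \<subseteq> A" for X
  proof -
    have "finite X" "card X \<le> 4" using that A card_mono[OF A(1) that] finite_subset by auto
    then show ?thesis
      using mom[unfolded same_moments_def, rule_format, of "mset_set X"] that A
      by (auto simp: prod_unfold_prod_mset)
  qed
  have noisy: "measure_pmf.expectation (noisy k D) (\<lambda>x. \<Prod>i\<in>#S. (of_bool (x i) :: real)) =
      (\<Sum>X\<in>Pow A. a ^ card X * b ^ card (A - X) * measure_pmf.expectation D (\<lambda>x. \<Prod>i\<in>X. (of_bool (x i) :: real)))"
    if finD: "finite (set_pmf D)" for D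
  proof -
    have inner: "measure_pmf.expectation (Pi_pmf {..<k} False (\<lambda>i. noise_pmf k (x i))) (\<lambda>y. \<Prod>i\<in>#S. (of_bool (y i) :: real))
        = (\<Sum>X\<in>Pow A. a ^ card X * b ^ card (A - X) * (\<Prod>i\<in>X. of_bool (x i)))" for x
    proof -
      have "(\<Prod>i\<in>#S. (of_bool (y i) :: real)) = (\<Prod>i<k. if i \<in> A then of_bool (y i) else 1)" for y
        unfolding prod_mset_of_bool A_def[symmetric]
        using A by (subst prod.inter_restrict[symmetric]) (auto simp: Int_absorb1)
      then have "measure_pmf.expectation (Pi_pmf {..<k} False (\<lambda>i. noise_pmf k (x i))) (\<lambda>y. \<Prod>i\<in>#S. (of_bool (y i) :: real))
          = (\<Prod>i<k. measure_pmf.expectation (noise_pmf k (x i)) (\<lambda>z. if i \<in> A then of_bool z else 1))"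
        by (simp only:) (rule expectation_prod_Pi_pmf_finite; simp)
      also have "\<dots> = (\<Prod>i<k. if i \<in> A then a * of_bool (x i) + b else 1)"
      proof (intro prod.cong refl)
        show "measure_pmf.expectation (noise_pmf k (x i)) (\<lambda>z. if i \<in> A then of_bool z else 1) =
            (if i \<in> A then a * of_bool (x i) + b else 1)" for i
          unfolding a_def b_def using pmf_noise(1)[OF k, of "x i"]
          by (cases "i \<in> A") (auto simp: expectation_bool_pmf)
      qed
      also have "\<dots> = (\<Prod>i\<in>A. a * of_bool (x i) + b)"
        using A by (subst prod.inter_restrict[symmetric]) (auto simp: Int_absorb1)
      also have "\<dots> = (\<Sum>X\<in>Pow A. (\<Prod>i\<in>X. a * of_bool (x i)) * (\<Prod>i\<in>A - X. b))"
        using A by (intro prod_add) auto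
      finally show ?thesis by (simp add: prod.distrib mult_ac)
    qed
    have "measure_pmf.expectation (noisy k D) (\<lambda>x. \<Prod>i\<in>#S. (of_bool (x i) :: real)) =
        measure_pmf.expectation D (\<lambda>x. \<Sum>X\<in>Pow A. a ^ card X * b ^ card (A - X) * (\<Prod>i\<in>X. of_bool (x i)))"
      unfolding noisy_def inner[symmetric] using finD
      by (intro expectation_bind_pmf_finite finite_set_Pi_pmf) auto
    also have "\<dots> = (\<Sum>X\<in>Pow A. a ^ card X * b ^ card (A - X) * measure_pmf.expectation D (\<lambda>x. \<Prod>i\<in>X. (of_bool (x i) :: real)))"
      using finD by (subst Bochner_Integration.integral_sum) (auto intro!: integrable_measure_pmf_finite)
    finally show ?thesis .
  qed
  show "measure_pmf.expectation (noisy k D0) (\<lambda>x. \<Prod>i\<in>#S. (of_bool (x i) :: real)) =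
     measure_pmf.expectation (noisy k D1) (\<lambda>x. \<Prod>i\<in>#S. (of_bool (x i) :: real))"
    unfolding noisy[OF fin(1)] noisy[OF fin(2)] using sub by (intro sum.cong) auto
qed

text \<open>The reindexing is injective, so point probabilities can be compared: both are the same
  double product, and both vanish at functions that leave the default \<open>d\<close> outside
  \<open>I \<times> A\<close>.\<close>

lemma Pi_pmf_Times:
  assumes "finite I" "finite A"
  shows "Pi_pmf (I \<times> A) d p =
    map_pmf (\<lambda>Y (i, j). Y j i) (Pi_pmf A (\<lambda>_. d) (\<lambda>j. Pi_pmf I d (\<lambda>i. p (i, j))))"
    (is "_ = map_pmf ?f ?P")
proof (rule pmf_eqI)
  fix y :: "'a \<times> 'b \<Rightarrow> 'c"
  define Y where "Y = (\<lambda>j i. y (i, j))"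
  have inj: "inj ?f" by (rule injI) (auto simp: fun_eq_iff)
  have y: "y = ?f Y" unfolding Y_def by auto
  have "pmf (map_pmf ?f ?P) y = pmf ?P Y" unfolding y using inj by (rule pmf_map_inj')
  also have "\<dots> = pmf (Pi_pmf (I \<times> A) d p) y"
  proof (cases "\<forall>x. x \<notin> I \<times> A \<longrightarrow> y x = d")
    case True
    then have "pmf ?P Y = (\<Prod>j\<in>A. \<Prod>i\<in>I. pmf (p (i, j)) (y (i, j)))"
      using assms by (subst pmf_Pi', auto simp: Y_def fun_eq_iff intro!: prod.cong pmf_Pi')
    also have "\<dots> = (\<Prod>i\<in>I. \<Prod>j\<in>A. pmf (p (i, j)) (y (i, j)))" by (rule prod.swap)
    also have "\<dots> = (\<Prod>x\<in>I \<times> A. pmf (p x) (y x))"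
      by (simp add: prod.cartesian_product)
    finally show ?thesis using True assms by (subst pmf_Pi') auto
  next
    case False
    then obtain i j where ij: "(i, j) \<notin> I \<times> A" "y (i, j) \<noteq> d" by auto
    have "pmf ?P Y = 0"
    proof (cases "j \<in> A")
      case True
      then have "i \<notin> I" using ij by auto
      then have "pmf (Pi_pmf I d (\<lambda>i. p (i, j))) (Y j) = 0"
        using assms ij by (intro pmf_Pi_outside) (auto simp: Y_def)
      then show ?thesis using assms True by (subst pmf_Pi) (auto intro!: prod_zero)
    next
      case False
      then show ?thesis using assms ij by (intro pmf_Pi_outside) (auto simp: Y_def fun_eq_iff)
    qed
    then show ?thesis using False assms by (subst pmf_Pi) auto
  qed
  finally show "pmf (Pi_pmf (I \<times> A) d p) y = pmf (map_pmf ?f ?P) y" ..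
qed

text \<open>The noise acts on each column separately, so the noisy columns are independent with law
  \<open>noisy k D\<close>, the form that \<open>lindeberg_exchange\<close> works with.\<close>

lemma noisy_matrix_columns:
  "noisy_matrix k R D = map_pmf (\<lambda>Y (i, j). Y j i) (Pi_pmf {..<R} (\<lambda>_. False) (\<lambda>_. noisy k D))"
proof -
  have "noisy_matrix k R D = map_pmf (\<lambda>Y (i, j). Y j i) (bind_pmf (Pi_pmf {..<R} (\<lambda>_. False) (\<lambda>_. D))
     (\<lambda>X. Pi_pmf {..<R} (\<lambda>_. False) (\<lambda>j. Pi_pmf {..<k} False (\<lambda>i. noise_pmf k (X j i)))))"
    unfolding noisy_matrix_def by (subst Pi_pmf_Times) (auto simp: map_bind_pmf)
  also have "\<dots> = map_pmf (\<lambda>Y (i, j). Y j i) (Pi_pmf {..<R} (\<lambda>_. False) (\<lambda>_. noisy k D))"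
    unfolding noisy_def by (subst Pi_pmf_bind[where d' = "\<lambda>_. False"]) auto
  finally show ?thesis .
qed

text \<open>Induction on \<open>m\<close> splits one factor off the power and moves its bit into the
  multiset; the total degree \<open>size S + m\<close> stays the same.\<close>

lemma moments_times_power:
  assumes fin: "finite (set_pmf Q0)" "finite (set_pmf Q1)" and mom: "same_moments k Q0 Q1"
    and T: "finite T" "T \<subseteq> {..<k}"
    and "set_mset S \<subseteq> {..<k}" "size S + m \<le> 4"
  shows "measure_pmf.expectation Q0 (\<lambda>y. (\<Prod>i\<in>#S. of_bool (y i)) * (\<Sum>i\<in>T. a i * of_bool (y i)) ^ m) =
    measure_pmf.expectation Q1 (\<lambda>y. (\<Prod>i\<in>#S. of_bool (y i)) * (\<Sum>i\<in>T. a i * of_bool (y i) :: real) ^ m)"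
  using assms(6-)
proof (induction m arbitrary: S)
  case 0
  then show ?case using mom unfolding same_moments_def by simp
next
  case (Suc m)
  define Z where "Z y = (\<Sum>i\<in>T. a i * of_bool (y i))" for y :: "nat \<Rightarrow> bool"
  have step: "measure_pmf.expectation Q (\<lambda>y. (\<Prod>i\<in>#S. of_bool (y i)) * Z y ^ Suc m) =
      (\<Sum>i\<in>T. a i * measure_pmf.expectation Q (\<lambda>y. (\<Prod>j\<in>#add_mset i S. of_bool (y j)) * Z y ^ m))"
    if "finite (set_pmf Q)" for Q
  proof -
    have "(\<Prod>i\<in>#S. of_bool (y i)) * Z y ^ Suc m =
        (\<Sum>i\<in>T. a i * ((\<Prod>j\<in>#add_mset i S. of_bool (y j)) * Z y ^ m))" for y
    proof -
      have "(\<Prod>i\<in>#S. of_bool (y i)) * Z y ^ Suc m = Z y * ((\<Prod>i\<in>#S. of_bool (y i)) * Z y ^ m)"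
        by (simp add: mult_ac)
      also have "\<dots> = (\<Sum>i\<in>T. (a i * of_bool (y i)) * ((\<Prod>i\<in>#S. of_bool (y i)) * Z y ^ m))"
        by (subst (1) Z_def) (rule sum_distrib_right)
      finally show ?thesis by (simp only: image_mset_add_mset prod_mset.add_mset mult.assoc)
    qed
    then show ?thesis
      using that by (simp only: Bochner_Integration.integral_sum integrable_measure_pmf_finite integral_mult_right_zero)
  qed
  have "measure_pmf.expectation Q0 (\<lambda>y. (\<Prod>j\<in>#add_mset i S. of_bool (y j)) * Z y ^ m) =
      measure_pmf.expectation Q1 (\<lambda>y. (\<Prod>j\<in>#add_mset i S. of_bool (y j)) * Z y ^ m)" if "i \<in> T" for i
    unfolding Z_def using Suc.prems T that by (intro Suc.IH) auto
  then show ?case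
    unfolding Z_def[symmetric] step[OF fin(1)] step[OF fin(2)] by (intro sum.cong) auto
qed

text \<open>Expanding to third order in the regular part leaves a polynomial of degree at most four in the bits
  of the column, since any function of the single remaining bit is affine.\<close>

lemma column_exchange:
  fixes a :: "nat \<Rightarrow> real" and \<Psi> :: "real \<Rightarrow> real"
  assumes k: "k \<ge> 1" and fin: "finite (set_pmf Q0)" "finite (set_pmf Q1)" and mom: "same_moments k Q0 Q1"
    and T: "T \<subseteq> {..<k}" "card ({..<k} - T) \<le> 1"
    and taylor: "\<And>s. \<exists>c. \<forall>z. \<bar>z\<bar> \<le> (\<Sum>i\<in>T. \<bar>a i\<bar>) \<longrightarrow> \<bar>\<Psi> (s + z) - (\<Sum>m\<le>(3::nat). c m * z ^ m)\<bar> \<le> e"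
  shows "\<bar>measure_pmf.expectation Q1 (\<lambda>y. \<Psi> (s + (\<Sum>i<k. a i * of_bool (y i)))) -
    measure_pmf.expectation Q0 (\<lambda>y. \<Psi> (s + (\<Sum>i<k. a i * of_bool (y i))))\<bar> \<le> 2 * e"
proof -
  define Z where "Z y = (\<Sum>i\<in>T. a i * of_bool (y i))" for y :: "nat \<Rightarrow> bool"
  have finT: "finite T" using T finite_subset by blast
  \<comment> \<open>If every bit lies in \<open>T\<close>, index 0 with coefficient
    \<open>g = 0\<close> serves as a dummy head bit.\<close>
  obtain i0 g where i0: "i0 < k"
    and split: "\<And>y. (\<Sum>i<k. a i * of_bool (y i)) = g * of_bool (y i0) + Z y"
  proof -
    have sd: "(\<Sum>i<k. a i * of_bool (y i)) = (\<Sum>i\<in>{..<k} - T. a i * of_bool (y i)) + Z y" for y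
      unfolding Z_def using T by (intro sum.subset_diff) auto
    have "card ({..<k} - T) = 0 \<or> card ({..<k} - T) = 1" using T(2) by linarith
    then show thesis
    proof
      assume "card ({..<k} - T) = 0"
      then have "{..<k} - T = {}" by simp
      then show thesis using sd k by (intro that[of 0 0]) (simp_all only: sum.empty)
    next
      assume "card ({..<k} - T) = 1"
      then obtain x where x: "{..<k} - T = {x}" by (auto simp: card_1_singleton_iff)
      then have "x < k" by auto
      then show thesis using sd x by (intro that[of x "a x"]) auto
    qed
  qed
  obtain c0 where c0: "\<And>z. \<bar>z\<bar> \<le> (\<Sum>i\<in>T. \<bar>a i\<bar>) \<Longrightarrow> \<bar>\<Psi> (s + z) - (\<Sum>m\<le>(3::nat). c0 m * z ^ m)\<bar> \<le> e"
    using taylor[of s] by blast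
  obtain c1 where c1: "\<And>z. \<bar>z\<bar> \<le> (\<Sum>i\<in>T. \<bar>a i\<bar>) \<Longrightarrow> \<bar>\<Psi> (s + g + z) - (\<Sum>m\<le>(3::nat). c1 m * z ^ m)\<bar> \<le> e"
    using taylor[of "s + g"] by blast
  \<comment> \<open>The head bit selects between the Taylor polynomials at \<open>s\<close> and at
    \<open>s + g\<close>; written as an affine function of that bit, the selection is a
    polynomial.\<close>
  define P where "P y = (\<Sum>m\<le>(3::nat). c0 m * Z y ^ m + (c1 m - c0 m) * (of_bool (y i0) * Z y ^ m))" for y
  have Zb: "\<bar>Z y\<bar> \<le> (\<Sum>i\<in>T. \<bar>a i\<bar>)" for y
    unfolding Z_def by (rule order_trans[OF sum_abs]) (auto intro!: sum_mono simp: of_bool_def)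
  have approx: "\<bar>\<Psi> (s + (\<Sum>i<k. a i * of_bool (y i))) - P y\<bar> \<le> e" for y
  proof (cases "y i0")
    case True
    have "P y = (\<Sum>m\<le>(3::nat). c1 m * Z y ^ m)"
      unfolding P_def using True by (intro sum.cong) (auto simp: algebra_simps)
    then show ?thesis unfolding split using c1[OF Zb[of y]] True by (simp add: add_ac)
  next
    case False
    then have "P y = (\<Sum>m\<le>(3::nat). c0 m * Z y ^ m)" unfolding P_def by simp
    then show ?thesis unfolding split using c0[OF Zb[of y]] False by simp
  qed
  have EP: "measure_pmf.expectation Q P = (\<Sum>m\<le>(3::nat). c0 m * measure_pmf.expectation Q (\<lambda>y. Z y ^ m) +
      (c1 m - c0 m) * measure_pmf.expectation Q (\<lambda>y. of_bool (y i0) * Z y ^ m))" if "finite (set_pmf Q)" for Q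
    unfolding P_def using that
    by (simp only: Bochner_Integration.integral_sum Bochner_Integration.integral_add integrable_measure_pmf_finite integral_mult_right_zero)
  have "measure_pmf.expectation Q0 P = measure_pmf.expectation Q1 P"
    unfolding EP[OF fin(1)] EP[OF fin(2)]
  proof (intro sum.cong refl arg_cong2[where f = "(+)"] arg_cong2[where f = "(*)"])
    fix m :: nat assume m: "m \<in> {..3}"
    show "measure_pmf.expectation Q0 (\<lambda>y. Z y ^ m) = measure_pmf.expectation Q1 (\<lambda>y. Z y ^ m)"
      using moments_times_power[OF fin mom finT T(1), of "{#}" m a] m unfolding Z_def by simp
    \<comment> \<open>The head bit and \<open>m \<le> 3\<close> tail factors have total degree at
      most four.\<close>
    show "measure_pmf.expectation Q0 (\<lambda>y. of_bool (y i0) * Z y ^ m) =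
        measure_pmf.expectation Q1 (\<lambda>y. of_bool (y i0) * Z y ^ m)"
      using moments_times_power[OF fin mom finT T(1), of "{#i0#}" m a] m i0 unfolding Z_def by simp
  qed
  moreover have "\<bar>measure_pmf.expectation Q (\<lambda>y. \<Psi> (s + (\<Sum>i<k. a i * of_bool (y i)))) - measure_pmf.expectation Q P\<bar> \<le> e"
    if "finite (set_pmf Q)" for Q
    using that approx by (intro abs_expectation_diff_le) auto
  ultimately show ?thesis using fin by (smt (verit))
qed

lemma finite_set_noisy_matrix:
  assumes "finite (set_pmf D)"
  shows "finite (set_pmf (noisy_matrix k R D))"
  unfolding noisy_matrix_columns using assms by (auto intro!: finite_set_Pi_pmf finite_set_noisy)

section \<open>Anticoncentration and indistinguishability for the whole matrix\<close>

text \<open>Bits within a clean column may be dependent; with the clean matrix \<open>X\<close>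
  fixed the entries become independent, and the noise alone supplies the anticoncentration.\<close>

lemma prob_noisy_matrix_le:
  assumes "finite (set_pmf D)"
    and "\<And>X. measure_pmf.prob (Pi_pmf ({..<k} \<times> {..<R}) False (\<lambda>(i,j). noise_pmf k (X j i))) E \<le> c"
  shows "measure_pmf.prob (noisy_matrix k R D) E \<le> c"
  unfolding noisy_matrix_def
  using assms by (intro prob_bind_pmf_le finite_set_Pi_pmf) auto

definition wsum :: "nat \<Rightarrow> nat \<Rightarrow> (nat \<Rightarrow> nat \<Rightarrow> real) \<Rightarrow> (nat \<times> nat \<Rightarrow> bool) \<Rightarrow> real" where
  "wsum k R w y = (\<Sum>i<k. \<Sum>j<R. w i j * of_bool (y (i, j)))"

lemma wsum_alt: "wsum k R w y = (\<Sum>x\<in>{..<k} \<times> {..<R}. (case x of (i, j) \<Rightarrow> w i j) * of_bool (y x))"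
  unfolding wsum_def by (simp only: sum.cartesian_product case_prod_unfold prod.collapse)

lemma wsum_columns: "wsum k R w (\<lambda>(i, j). Y j i) = (\<Sum>j<R. \<Sum>i<k. w i j * of_bool (Y j i))"
  unfolding wsum_def by (simp only: case_prod_conv) (rule sum.swap)

text \<open>The noise gives every entry a variance of at least
  \<open>1 / (4 * (real k)\<^sup>2)\<close>, so the part \<open>T\<close> spreads the sum over the
  scale \<open>\<sigma> / (2 * real k)\<close>.\<close>

lemma noisy_matrix_anticoncentration:
  assumes k: "k \<ge> 2" and fin: "finite (set_pmf D)" and l: "l > 0"
    and T: "T \<subseteq> {..<k} \<times> {..<R}" and small: "\<And>i j. (i, j) \<in> T \<Longrightarrow> \<bar>w i j\<bar> \<le> l"
    and W: "(\<Sum>(i, j)\<in>T. (w i j)\<^sup>2) = \<sigma>\<^sup>2" "\<sigma> > 0"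
  shows "measure_pmf.prob (noisy_matrix k R D) {y. \<bar>wsum k R w y - c\<bar> \<le> l} \<le> 8 * pi * l * real k / \<sigma>"
proof (rule prob_noisy_matrix_le[OF fin])
  fix X
  have v: "1 / (4 * (real k)\<^sup>2) > 0" using k by simp
  have "measure_pmf.prob (Pi_pmf ({..<k} \<times> {..<R}) False (\<lambda>(i,j). noise_pmf k (X j i))) {y. \<bar>wsum k R w y - c\<bar> \<le> l}
      \<le> 4 * pi * l / sqrt (1 / (4 * (real k)\<^sup>2) * (\<Sum>x\<in>T. (case x of (i, j) \<Rightarrow> w i j)\<^sup>2))"
    unfolding wsum_alt
  proof (rule Pi_pmf_bool_anticoncentration[OF _ T l _ v])
    show "1 / (4 * (real k)\<^sup>2) \<le> pmf (case x of (i, j) \<Rightarrow> noise_pmf k (X j i)) True *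
        pmf (case x of (i, j) \<Rightarrow> noise_pmf k (X j i)) False" for x
      using noise_bounds(2)[OF k] by (cases x) auto
    have "(\<Sum>x\<in>T. (case x of (i, j) \<Rightarrow> w i j)\<^sup>2) = \<sigma>\<^sup>2"
      using W(1) by (simp add: case_prod_unfold)
    then show "(\<Sum>x\<in>T. (case x of (i, j) \<Rightarrow> w i j)\<^sup>2) > 0" using W(2) by simp
  qed (use small in auto)
  also have "sqrt (1 / (4 * (real k)\<^sup>2) * (\<Sum>x\<in>T. (case x of (i, j) \<Rightarrow> w i j)\<^sup>2)) = \<sigma> / (2 * real k)"
    using W by (simp add: case_prod_unfold real_sqrt_divide real_sqrt_mult)
  finally show "measure_pmf.prob (Pi_pmf ({..<k} \<times> {..<R}) False (\<lambda>(i,j). noise_pmf k (X j i)))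
      {y. \<bar>wsum k R w y - c\<bar> \<le> l} \<le> 8 * pi * l * real k / \<sigma>"
    by simp
qed

lemma regular_rows_indistinguishable:
  fixes w :: "nat \<Rightarrow> nat \<Rightarrow> real" and H :: "nat \<Rightarrow> nat set"
  assumes k: "k \<ge> 2" and fin: "finite (set_pmf D0)" "finite (set_pmf D1)" and mom: "same_moments k D0 D1"
    and disj: "\<And>i i'. i < k \<Longrightarrow> i' < k \<Longrightarrow> i \<noteq> i' \<Longrightarrow> H i \<inter> H i' = {}"
    and reg: "\<And>i j. i < k \<Longrightarrow> j \<in> {..<R} - H i \<Longrightarrow>
      (w i j)\<^sup>2 \<le> (1 / real k ^ 7)\<^sup>2 * (\<Sum>j\<in>{..<R} - H i. (w i j)\<^sup>2)"
  shows "\<bar>measure_pmf.prob (noisy_matrix k R D1) {y. wsum k R w y \<ge> \<theta>} -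
    measure_pmf.prob (noisy_matrix k R D0) {y. wsum k R w y \<ge> \<theta>}\<bar> \<le> (2 + 5504 * pi) / real k"
proof -
  define Q0 Q1 where "Q0 = noisy k D0" and "Q1 = noisy k D1"
  have finQ: "finite (set_pmf Q0)" "finite (set_pmf Q1)" and momQ: "same_moments k Q0 Q1"
    unfolding Q0_def Q1_def using fin mom k by (auto intro!: finite_set_noisy same_moments_noisy)
  define V where "V = (\<Sum>i<k. \<Sum>j\<in>{..<R} - H i. (w i j)\<^sup>2)"
  define T where "T j = {i. i < k \<and> j \<notin> H i}" for j
  define B where "B j = (\<Sum>i\<in>T j. \<bar>w i j\<bar>)" for j
  have V0: "V \<ge> 0" unfolding V_def by (intro sum_nonneg) auto
  have T: "T j \<subseteq> {..<k}" "card ({..<k} - T j) \<le> 1" "finite (T j)" for j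
  proof -
    show "T j \<subseteq> {..<k}" unfolding T_def by auto
    then show "finite (T j)" using finite_subset by blast
    \<comment> \<open>Heads of different rows are disjoint, so column \<open>j\<close> meets at most
      one of them.\<close>
    show "card ({..<k} - T j) \<le> 1"
      unfolding One_nat_def using disj by (subst card_le_Suc0_iff_eq) (auto simp: T_def)
  qed
  have regV: "(w i j)\<^sup>2 \<le> (1 / real k ^ 7)\<^sup>2 * V" if "i < k" "j < R" "j \<notin> H i" for i j
  proof -
    have "(\<Sum>j\<in>{..<R} - H i. (w i j)\<^sup>2) \<le> V"
      unfolding V_def using that by (intro member_le_sum) (auto intro: sum_nonneg)
    then have "(1 / real k ^ 7)\<^sup>2 * (\<Sum>j\<in>{..<R} - H i. (w i j)\<^sup>2) \<le> (1 / real k ^ 7)\<^sup>2 * V"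
      by (intro mult_left_mono) auto
    then show ?thesis using order_trans[OF reg[of i j]] that by blast
  qed
  have swap: "(\<Sum>j<R. \<Sum>i\<in>T j. f i j) = (\<Sum>i<k. \<Sum>j\<in>{..<R} - H i. f i j)" for f :: "nat \<Rightarrow> nat \<Rightarrow> real"
  proof -
    have "(\<Sum>j<R. \<Sum>i\<in>T j. f i j) = (\<Sum>j\<in>{..<R}. \<Sum>i\<in>{i \<in> {..<k}. j \<notin> H i}. f i j)"
      unfolding T_def by simp
    also have "\<dots> = (\<Sum>i\<in>{..<k}. \<Sum>j\<in>{j \<in> {..<R}. j \<notin> H i}. f i j)"
      by (rule sum.swap_restrict) auto
    finally show ?thesis by (simp add: set_diff_eq)
  qed
  \<comment> \<open>Stated for any \<open>\<Psi>\<close>, since it is applied both to the step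
    function itself and to the spline.\<close>
  have exch: "\<bar>measure_pmf.expectation (noisy_matrix k R D1) (\<lambda>y. \<Psi> (wsum k R w y - \<theta>)) -
      measure_pmf.expectation (noisy_matrix k R D0) (\<lambda>y. \<Psi> (wsum k R w y - \<theta>))\<bar> \<le> (\<Sum>j<R. 2 * e j)"
    if "\<And>j s. j < R \<Longrightarrow> \<exists>c. \<forall>z. \<bar>z\<bar> \<le> B j \<longrightarrow> \<bar>\<Psi> (s + z) - (\<Sum>m\<le>(3::nat). c m * z ^ m)\<bar> \<le> e j"
    for \<Psi> :: "real \<Rightarrow> real" and e
  proof -
    have "\<bar>measure_pmf.expectation (Pi_pmf {..<R} (\<lambda>_. False) (\<lambda>_. Q1)) (\<lambda>Y. \<Psi> (- \<theta> + (\<Sum>j<R. \<Sum>i<k. w i j * of_bool (Y j i)))) -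
        measure_pmf.expectation (Pi_pmf {..<R} (\<lambda>_. False) (\<lambda>_. Q0)) (\<lambda>Y. \<Psi> (- \<theta> + (\<Sum>j<R. \<Sum>i<k. w i j * of_bool (Y j i))))\<bar>
        \<le> (\<Sum>j<R. 2 * e j)"
    proof (rule lindeberg_exchange[OF _ finQ, where L = "\<lambda>j y. \<Sum>i<k. w i j * of_bool (y i)"])
      show "\<bar>measure_pmf.expectation Q1 (\<lambda>y. \<Psi> (c + (\<Sum>i<k. w i j * of_bool (y i)))) -
          measure_pmf.expectation Q0 (\<lambda>y. \<Psi> (c + (\<Sum>i<k. w i j * of_bool (y i))))\<bar> \<le> 2 * e j"
        if "j \<in> {..<R}" for j c
        using k that \<open>\<And>j s. j < R \<Longrightarrow> \<exists>c. \<forall>z. \<bar>z\<bar> \<le> B j \<longrightarrow> \<bar>\<Psi> (s + z) - (\<Sum>m\<le>(3::nat). c m * z ^ m)\<bar> \<le> e j\<close>[of j]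
        by (intro column_exchange[OF _ finQ momQ T(1,2)[of j]]) (auto simp: B_def)
    qed simp
    then show ?thesis
      unfolding noisy_matrix_columns Q0_def Q1_def by (simp add: wsum_columns)
  qed
  have prob: "measure_pmf.prob P {y. wsum k R w y \<ge> \<theta>} =
      measure_pmf.expectation P (\<lambda>y. of_bool (wsum k R w y - \<theta> \<ge> 0))" for P
  proof -
    have "measure_pmf.prob P {y. wsum k R w y \<ge> \<theta>} = measure_pmf.expectation P (indicator {y. wsum k R w y \<ge> \<theta>})"
      by simp
    also have "indicator {y. wsum k R w y \<ge> \<theta>} = (\<lambda>y. of_bool (wsum k R w y - \<theta> \<ge> 0) :: real)"
      by (auto simp: fun_eq_iff indicator_def)
    finally show ?thesis .
  qed
  show ?thesis
  proof (cases "V = 0")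
    case True
    \<comment> \<open>All tails vanish, so each column contributes through at most one bit and even
      the step function can be exchanged with error 0.\<close>
    have "w i j = 0" if "i < k" "j < R" "j \<notin> H i" for i j
      using regV[OF that] True by simp
    then have B0: "B j = 0" if "j < R" for j unfolding B_def T_def using that by (intro sum.neutral) auto
    have "\<bar>measure_pmf.expectation (noisy_matrix k R D1) (\<lambda>y. of_bool (wsum k R w y - \<theta> \<ge> 0)) -
      measure_pmf.expectation (noisy_matrix k R D0) (\<lambda>y. of_bool (wsum k R w y - \<theta> \<ge> 0) :: real)\<bar> \<le> (\<Sum>j<R. 2 * 0)"
    proof (rule exch)
      fix j :: nat and s :: real assume "j < R"
      then show "\<exists>c. \<forall>z. \<bar>z\<bar> \<le> B j \<longrightarrow> \<bar>of_bool (s + z \<ge> 0) - (\<Sum>m\<le>(3::nat). c m * z ^ m)\<bar> \<le> (0::real)"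
        using B0 by (intro exI[of _ "\<lambda>m. if m = 0 then of_bool (s \<ge> 0) else 0"]) (auto simp: numeral_3_eq_3)
    qed
    moreover have "0 \<le> (2 + 5504 * pi) / real k" by simp
    ultimately show ?thesis unfolding prob by simp
  next
    case False
    define \<sigma> where "\<sigma> = sqrt V"
    have \<sigma>: "\<sigma> > 0" "\<sigma>\<^sup>2 = V" unfolding \<sigma>_def using False V0 by auto
    \<comment> \<open>The scale is a factor \<open>k\<close> below the spread
      \<open>\<sigma> / k\<close> due to the noise, yet large enough to keep the fourth-order
      remainders small.\<close>
    define l where "l = \<sigma> / (real k)\<^sup>2"
    have l: "l > 0" unfolding l_def using \<sigma> k by simp
    have kpos: "real k > 0" "real k \<ge> 1" using k by auto
    have lind: "\<bar>measure_pmf.expectation (noisy_matrix k R D1) (\<lambda>y. spline_step l (wsum k R w y - \<theta>)) -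
        measure_pmf.expectation (noisy_matrix k R D0) (\<lambda>y. spline_step l (wsum k R w y - \<theta>))\<bar> \<le> (\<Sum>j<R. 2 * (B j ^ 4 / l ^ 4))"
    proof (rule exch)
      fix j s assume "j < R"
      obtain c where c: "\<And>z. \<bar>spline_step l (s + z) - (\<Sum>m\<le>(3::nat). c m * z ^ m)\<bar> \<le> z ^ 4 / l ^ 4"
        using spline_step_taylor[OF l, of s] by blast
      have "z ^ 4 / l ^ 4 \<le> B j ^ 4 / l ^ 4" if "\<bar>z\<bar> \<le> B j" for z
      proof -
        have "\<bar>z\<bar> ^ 4 \<le> B j ^ 4" using that by (intro power_mono) auto
        then show ?thesis using l by (intro divide_right_mono) auto
      qed
      then show "\<exists>c. \<forall>z. \<bar>z\<bar> \<le> B j \<longrightarrow> \<bar>spline_step l (s + z) - (\<Sum>m\<le>(3::nat). c m * z ^ m)\<bar> \<le> B j ^ 4 / l ^ 4"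
        using c by (intro exI[of _ c]) (meson order_trans)
    qed
    \<comment> \<open>Two applications of Cauchy-Schwarz over at most \<open>k\<close> rows give
      \<open>k ^ 3\<close>, rounded up to \<open>k ^ 4\<close>.\<close>
    have B4: "B j ^ 4 \<le> real k ^ 4 * (\<Sum>i\<in>T j. (w i j) ^ 4)" for j
    proof -
      have sq: "(\<Sum>i\<in>T j. f i)\<^sup>2 \<le> real k * (\<Sum>i\<in>T j. (f i)\<^sup>2)" for f :: "nat \<Rightarrow> real"
      proof -
        have "card (T j) \<le> k" using card_mono[OF _ T(1)[of j]] by simp
        then have "(\<Sum>i\<in>T j. (f i)\<^sup>2) * real (card (T j)) \<le> (\<Sum>i\<in>T j. (f i)\<^sup>2) * real k"
          by (intro mult_left_mono) (auto intro: sum_nonneg)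
        then show ?thesis using sum_squared_le_sum_of_squares[of f "T j"] by (simp add: mult.commute)
      qed
      have "(B j)\<^sup>2 \<le> real k * (\<Sum>i\<in>T j. (w i j)\<^sup>2)"
        unfolding B_def using sq[of "\<lambda>i. \<bar>w i j\<bar>"] by simp
      then have "((B j)\<^sup>2)\<^sup>2 \<le> (real k * (\<Sum>i\<in>T j. (w i j)\<^sup>2))\<^sup>2" by (intro power_mono) auto
      also have "\<dots> = (real k)\<^sup>2 * (\<Sum>i\<in>T j. (w i j)\<^sup>2)\<^sup>2" by (rule power_mult_distrib)
      also have "\<dots> \<le> (real k)\<^sup>2 * (real k * (\<Sum>i\<in>T j. ((w i j)\<^sup>2)\<^sup>2))"
        by (intro mult_left_mono sq) auto
      also have "\<dots> = real k ^ 3 * (\<Sum>i\<in>T j. (w i j) ^ 4)"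
        by (simp add: power2_eq_square power3_eq_cube power4_eq_xxxx mult.assoc)
      also have "\<dots> \<le> real k ^ 4 * (\<Sum>i\<in>T j. (w i j) ^ 4)"
        using kpos by (intro mult_right_mono power_increasing sum_nonneg) auto
      finally show ?thesis by (simp add: power_mult[symmetric])
    qed
    have "(\<Sum>j<R. B j ^ 4) \<le> (\<Sum>j<R. real k ^ 4 * (\<Sum>i\<in>T j. (w i j) ^ 4))"
      by (intro sum_mono B4)
    also have "\<dots> = real k ^ 4 * (\<Sum>j<R. \<Sum>i\<in>T j. (w i j) ^ 4)"
      by (simp only: sum_distrib_left)
    also have "(\<Sum>j<R. \<Sum>i\<in>T j. (w i j) ^ 4) = (\<Sum>i<k. \<Sum>j\<in>{..<R} - H i. (w i j) ^ 4)" by (rule swap)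
    also have "\<dots> \<le> (\<Sum>i<k. \<Sum>j\<in>{..<R} - H i. (1 / real k ^ 7)\<^sup>2 * V * (w i j)\<^sup>2)"
    proof (intro sum_mono)
      fix i j assume "i \<in> {..<k}" "j \<in> {..<R} - H i"
      then have "(w i j)\<^sup>2 * (w i j)\<^sup>2 \<le> (1 / real k ^ 7)\<^sup>2 * V * (w i j)\<^sup>2"
        by (intro mult_right_mono regV) auto
      then show "(w i j) ^ 4 \<le> (1 / real k ^ 7)\<^sup>2 * V * (w i j)\<^sup>2" by (simp add: power_add[symmetric])
    qed
    also have "\<dots> = (1 / real k ^ 7)\<^sup>2 * V * V" unfolding V_def by (simp only: sum_distrib_left)
    finally have "(\<Sum>j<R. B j ^ 4) \<le> real k ^ 4 * ((1 / real k ^ 7)\<^sup>2 * V * V)"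
      by (simp add: mult_left_mono)
    then have "(\<Sum>j<R. B j ^ 4) / l ^ 4 \<le> real k ^ 4 * ((1 / real k ^ 7)\<^sup>2 * V * V) / l ^ 4"
      using l by (intro divide_right_mono) auto
    \<comment> \<open>Exponents of \<open>k\<close>: 4 from Cauchy-Schwarz, -14 from regularity and
      8 from \<open>l ^ 4\<close>, in total -2.\<close>
    also have "\<dots> = 1 / (real k)\<^sup>2"
    proof -
      have l4: "l ^ 4 = V * V / real k ^ 8"
        unfolding l_def \<sigma>(2)[symmetric] by (simp add: power_divide power_mult[symmetric] power_add[symmetric])
      show ?thesis unfolding l4 using kpos False
        by (simp add: field_simps power_mult[symmetric] power_add[symmetric])
    qed
    also have "\<dots> \<le> 1 / real k" using kpos by (simp add: field_simps power2_eq_square)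
    finally have "(\<Sum>j<R. 2 * (B j ^ 4 / l ^ 4)) \<le> 2 / real k"
      by (simp add: sum_distrib_left[symmetric] sum_divide_distrib[symmetric])
    with lind have main: "\<bar>measure_pmf.expectation (noisy_matrix k R D1) (\<lambda>y. spline_step l (wsum k R w y - \<theta>)) -
        measure_pmf.expectation (noisy_matrix k R D0) (\<lambda>y. spline_step l (wsum k R w y - \<theta>))\<bar> \<le> 2 / real k"
      by linarith
    have smooth: "\<bar>measure_pmf.prob (noisy_matrix k R D) {y. wsum k R w y \<ge> \<theta>} -
        measure_pmf.expectation (noisy_matrix k R D) (\<lambda>y. spline_step l (wsum k R w y - \<theta>))\<bar> \<le> 2752 * pi / real k"
      if finD: "finite (set_pmf D)" for D
    proof -
      define P where "P = noisy_matrix k R D"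
      \<comment> \<open>Spline and step can differ only where the sum exceeds
        \<open>\<theta>\<close> by an amount in \<open>[0, 4 * l]\<close>, an interval centred at
        \<open>\<theta> + 2 * l\<close>. The factor 172 below is \<open>171 + 1\<close>.\<close>
      define E where "E = {y. \<bar>wsum k R w y - (\<theta> + 2 * l)\<bar> \<le> 2 * l}"
      have finP: "finite (set_pmf P)" unfolding P_def by (rule finite_set_noisy_matrix[OF finD])
      have pt: "\<bar>of_bool (wsum k R w y - \<theta> \<ge> 0) - spline_step l (wsum k R w y - \<theta>)\<bar> \<le> 172 * indicator E y" for y
      proof -
        let ?s = "wsum k R w y - \<theta>"
        consider "?s < 0" | "0 \<le> ?s" "?s \<le> 4 * l" | "?s > 4 * l" by linarith
        then show ?thesis
        proof cases
          case 1
          then show ?thesis using spline_step_eq_0[OF l, of ?s] by (simp add: indicator_def)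
        next
          case 2
          then have "y \<in> E" unfolding E_def by (simp add: abs_le_iff)
          then show ?thesis using 2 abs_spline_step_le[OF l 2] by simp
        next
          case 3
          then show ?thesis using spline_step_eq_1[OF l, of ?s] l by (simp add: indicator_def)
        qed
      qed
      have "\<bar>measure_pmf.expectation P (\<lambda>y. of_bool (wsum k R w y - \<theta> \<ge> 0)) -
          measure_pmf.expectation P (\<lambda>y. spline_step l (wsum k R w y - \<theta>))\<bar> =
          \<bar>measure_pmf.expectation P (\<lambda>y. of_bool (wsum k R w y - \<theta> \<ge> 0) - spline_step l (wsum k R w y - \<theta>))\<bar>"
        using finP by (subst Bochner_Integration.integral_diff) (auto intro: integrable_measure_pmf_finite)
      also have "\<dots> \<le> measure_pmf.expectation P (\<lambda>y. \<bar>of_bool (wsum k R w y - \<theta> \<ge> 0) - spline_step l (wsum k R w y - \<theta>)\<bar>)"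
        by (rule integral_abs_bound)
      also have "\<dots> \<le> measure_pmf.expectation P (\<lambda>y. 172 * indicator E y)"
        using finP pt by (intro expectation_mono_finite) auto
      also have "\<dots> = 172 * measure_pmf.prob P E" by simp
      also have "measure_pmf.prob P E \<le> 8 * pi * (2 * l) * real k / \<sigma>"
        unfolding P_def E_def
      proof (rule noisy_matrix_anticoncentration[OF k finD, where T = "SIGMA i:{..<k}. {..<R} - H i"])
        show "(SIGMA i:{..<k}. {..<R} - H i) \<subseteq> {..<k} \<times> {..<R}" by auto
        show "(\<Sum>(i, j)\<in>(SIGMA i:{..<k}. {..<R} - H i). (w i j)\<^sup>2) = \<sigma>\<^sup>2"
          unfolding \<sigma>(2) V_def by (subst sum.Sigma) auto
        \<comment> \<open>Regularity bounds a tail coefficient by \<open>\<sigma> / k ^ 7\<close>,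
          which is at most \<open>l = \<sigma> / k ^ 2\<close>.\<close>
        show "\<bar>w i j\<bar> \<le> 2 * l" if "(i, j) \<in> (SIGMA i:{..<k}. {..<R} - H i)" for i j
        proof -
          have "(w i j)\<^sup>2 \<le> (1 / real k ^ 7)\<^sup>2 * V" using that by (intro regV) auto
          also have "\<dots> \<le> (1 / (real k)\<^sup>2)\<^sup>2 * V"
            using kpos V0 by (intro mult_right_mono power_mono divide_left_mono power_increasing) auto
          also have "\<dots> = l\<^sup>2" unfolding l_def \<sigma>(2)[symmetric] by (simp add: power_divide)
          finally have "\<bar>w i j\<bar> \<le> l" using l by (simp add: abs_le_square_iff[symmetric])
          then show ?thesis using l by simp
        qed
      qed (use l \<sigma> in auto)
      \<comment> \<open>With the factor 172 this becomes
        \<open>172 * 16 * pi = 2752 * pi\<close>.\<close>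
      also have "8 * pi * (2 * l) * real k / \<sigma> = 16 * pi / real k"
        unfolding l_def using \<sigma>(1) kpos by (simp add: field_simps power2_eq_square)
      finally show ?thesis unfolding prob P_def by simp
    qed
    have "2 / real k + 2752 * pi / real k + 2752 * pi / real k = (2 + 5504 * pi) / real k"
      by (simp add: add_divide_distrib)
    then show ?thesis using main smooth[OF fin(1)] smooth[OF fin(2)] by linarith
  qed
qed

section \<open>Truncating irregular rows\<close>

lemma prob_threshold_diff_le:
  assumes close: "\<And>y. \<bar>f y - g y\<bar> \<le> (r::real)"
  shows "\<bar>measure_pmf.prob P {y. f y \<ge> \<theta>} - measure_pmf.prob P {y. g y \<ge> \<theta>}\<bar> \<le>
    measure_pmf.prob P {y. \<bar>g y - \<theta>\<bar> \<le> r}"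
proof -
  have near: "\<bar>g y - \<theta>\<bar> \<le> r" if "(f y \<ge> \<theta>) \<noteq> (g y \<ge> \<theta>)" for y
    using that close[of y] by linarith
  have "measure_pmf.prob P {y. f y \<ge> \<theta>} \<le> measure_pmf.prob P ({y. g y \<ge> \<theta>} \<union> {y. \<bar>g y - \<theta>\<bar> \<le> r})"
    using near by (intro measure_pmf.finite_measure_mono) auto
  also have "\<dots> \<le> measure_pmf.prob P {y. g y \<ge> \<theta>} + measure_pmf.prob P {y. \<bar>g y - \<theta>\<bar> \<le> r}"
    by (rule measure_Un_le) auto
  finally have 1: "measure_pmf.prob P {y. f y \<ge> \<theta>} \<le>
    measure_pmf.prob P {y. g y \<ge> \<theta>} + measure_pmf.prob P {y. \<bar>g y - \<theta>\<bar> \<le> r}" .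
  have "measure_pmf.prob P {y. g y \<ge> \<theta>} \<le> measure_pmf.prob P ({y. f y \<ge> \<theta>} \<union> {y. \<bar>g y - \<theta>\<bar> \<le> r})"
    using near by (intro measure_pmf.finite_measure_mono) auto
  also have "\<dots> \<le> measure_pmf.prob P {y. f y \<ge> \<theta>} + measure_pmf.prob P {y. \<bar>g y - \<theta>\<bar> \<le> r}"
    by (rule measure_Un_le) auto
  finally show ?thesis using 1 by linarith
qed

definition truncate_rows :: "nat set \<Rightarrow> (nat \<Rightarrow> nat set) \<Rightarrow> (nat \<Rightarrow> nat \<Rightarrow> real) \<Rightarrow> nat \<Rightarrow> nat \<Rightarrow> real" where
  "truncate_rows F H w i j = (if i \<in> F \<and> j \<notin> H i then 0 else w i j)"

text \<open>The second alternative of \<open>critical_index_dichotomy\<close>. The constant 5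
  ensures that twice the discarded tail, at most \<open>2/5\<close> of the last coefficient, is
  below the separation \<open>1/2\<close> of \<open>geometric_sums_separated\<close>.\<close>

definition geometric_head :: "nat \<Rightarrow> nat \<Rightarrow> nat set \<Rightarrow> (nat \<Rightarrow> real) \<Rightarrow> bool" where
  "geometric_head m n A u \<longleftrightarrow> (\<exists>g. inj_on g {..<m} \<and> g ` {..<m} \<subseteq> A \<and>
     (\<forall>a. Suc a < m \<longrightarrow> \<bar>u (g (Suc a))\<bar> \<le> \<bar>u (g a)\<bar> / 3) \<and>
     u (g (m - 1)) \<noteq> 0 \<and> (\<Sum>j\<in>{..<n} - A. \<bar>u j\<bar>) \<le> \<bar>u (g (m - 1))\<bar> / 5)"

text \<open>Rows are truncated one at a time. Dropping a tail moves the sum by at most its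
  \<open>l1\<close> norm, so the output changes only if the truncated sum falls within that distance
  of \<open>\<theta>\<close>; the geometric head of the row makes this unlikely.\<close>

lemma prob_truncate_rows:
  assumes k: "k \<ge> 2" and fin: "finite (set_pmf D)" and m: "m \<ge> 1"
    and F: "finite F" "F \<subseteq> {..<k}" and H: "\<And>i. i \<in> F \<Longrightarrow> H i \<subseteq> {..<R}"
    and geo: "\<And>i. i \<in> F \<Longrightarrow> geometric_head m R (H i) (w i)"
  shows "\<bar>measure_pmf.prob (noisy_matrix k R D) {y. wsum k R w y \<ge> \<theta>} -
      measure_pmf.prob (noisy_matrix k R D) {y. wsum k R (truncate_rows F H w) y \<ge> \<theta>}\<bar>
    \<le> real (card F) * (1 - 1 / (2 * (real k)\<^sup>2)) ^ m"
  using F H geo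
proof (induction F rule: finite_induct)
  case empty
  have "truncate_rows {} H w = w" by (simp add: truncate_rows_def fun_eq_iff)
  then show ?case by simp
next
  case (insert i F)
  define P where "P = noisy_matrix k R D"
  define w1 w2 where "w1 = truncate_rows F H w" and "w2 = truncate_rows (insert i F) H w"
  have i: "i < k" "H i \<subseteq> {..<R}" using insert.prems by auto
  obtain g where g: "inj_on g {..<m}" "g ` {..<m} \<subseteq> H i"
      "\<And>a. Suc a < m \<Longrightarrow> \<bar>w i (g (Suc a))\<bar> \<le> \<bar>w i (g a)\<bar> / 3"
      "w i (g (m - 1)) \<noteq> 0" "(\<Sum>j\<in>{..<R} - H i. \<bar>w i j\<bar>) \<le> \<bar>w i (g (m - 1))\<bar> / 5"
    using insert.prems(3)[of i] unfolding geometric_head_def by auto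
  define r where "r = (\<Sum>j\<in>{..<R} - H i. \<bar>w i j\<bar>)"
  have diff: "w1 i' j - w2 i' j = (if i' = i \<and> j \<notin> H i then w i j else 0)" for i' j
    using insert.hyps unfolding w1_def w2_def truncate_rows_def by auto
  \<comment> \<open>The head survives the truncation, so \<open>w2\<close> still contains the
    geometric coefficients.\<close>
  have head: "w2 i (g a) = w i (g a)" if "a < m" for a
    using g(2) that unfolding w2_def truncate_rows_def by auto
  have "\<bar>wsum k R w1 y - wsum k R w2 y\<bar> \<le> r" for y
  proof -
    have "wsum k R w1 y - wsum k R w2 y = (\<Sum>i'<k. \<Sum>j<R. (w1 i' j - w2 i' j) * of_bool (y (i', j)))"
      unfolding wsum_def by (simp only: left_diff_distrib sum_subtractf)
    also have "\<dots> = (\<Sum>i'<k. if i' = i then \<Sum>j<R. (w1 i j - w2 i j) * of_bool (y (i, j)) else 0)"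
      by (intro sum.cong refl) (simp only: diff, auto)
    also have "\<dots> = (\<Sum>j<R. (w1 i j - w2 i j) * of_bool (y (i, j)))"
      using i by simp
    also have "\<bar>\<dots>\<bar> \<le> (\<Sum>j<R. \<bar>(w1 i j - w2 i j) * of_bool (y (i, j))\<bar>)" by (rule sum_abs)
    also have "\<dots> \<le> (\<Sum>j<R. if j \<in> {..<R} - H i then \<bar>w i j\<bar> else 0)"
      unfolding diff by (intro sum_mono) auto
    also have "\<dots> = r" unfolding r_def by (subst sum.inter_restrict[symmetric]) (auto simp: Int_absorb1)
    finally show ?thesis .
  qed
  then have "\<bar>measure_pmf.prob P {y. wsum k R w1 y \<ge> \<theta>} - measure_pmf.prob P {y. wsum k R w2 y \<ge> \<theta>}\<bar>
      \<le> measure_pmf.prob P {y. \<bar>wsum k R w2 y - \<theta>\<bar> \<le> r}"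
    unfolding P_def by (rule prob_threshold_diff_le)
  also have "\<dots> \<le> (1 - 1 / (2 * (real k)\<^sup>2)) ^ m"
    unfolding P_def
  proof (rule prob_noisy_matrix_le[OF fin])
    fix X
    show "measure_pmf.prob (Pi_pmf ({..<k} \<times> {..<R}) False (\<lambda>(i,j). noise_pmf k (X j i)))
        {y. \<bar>wsum k R w2 y - \<theta>\<bar> \<le> r} \<le> (1 - 1 / (2 * (real k)\<^sup>2)) ^ m"
      unfolding wsum_alt
    proof (rule Pi_pmf_geometric_anticoncentration[where g = "\<lambda>a. (i, g a)"])
      show "inj_on (\<lambda>a. (i, g a)) {..<m}" using g(1) by (auto simp: inj_on_def)
      show "(\<lambda>a. (i, g a)) ` {..<m} \<subseteq> {..<k} \<times> {..<R}" using g(2) i by auto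
      show "\<bar>case (i, g (Suc a)) of (i, j) \<Rightarrow> w2 i j\<bar> \<le> \<bar>case (i, g a) of (i, j) \<Rightarrow> w2 i j\<bar> / 3" if "Suc a < m" for a
        using g(3)[OF that] head[of a] head[of "Suc a"] that by simp
      show "2 * r < \<bar>case (i, g (m - 1)) of (i, j) \<Rightarrow> w2 i j\<bar> / 2"
        using g(4,5) head[of "m - 1"] m unfolding r_def by simp
      show "pmf (case x of (i, j) \<Rightarrow> noise_pmf k (X j i)) b \<le> 1 - 1 / (2 * (real k)\<^sup>2)" for x b
        using noise_bounds(1)[OF k] by (cases x) auto
    qed simp
  qed
  finally have "\<bar>measure_pmf.prob P {y. wsum k R w1 y \<ge> \<theta>} - measure_pmf.prob P {y. wsum k R w2 y \<ge> \<theta>}\<bar>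
      \<le> (1 - 1 / (2 * (real k)\<^sup>2)) ^ m" .
  moreover have "\<bar>measure_pmf.prob P {y. wsum k R w y \<ge> \<theta>} - measure_pmf.prob P {y. wsum k R w1 y \<ge> \<theta>}\<bar>
      \<le> real (card F) * (1 - 1 / (2 * (real k)\<^sup>2)) ^ m"
    unfolding P_def w1_def using insert by auto
  moreover have "real (card (insert i F)) * (1 - 1 / (2 * (real k)\<^sup>2)) ^ m =
      real (card F) * (1 - 1 / (2 * (real k)\<^sup>2)) ^ m + (1 - 1 / (2 * (real k)\<^sup>2)) ^ m"
    using insert.hyps by (simp add: algebra_simps)
  ultimately show ?case unfolding P_def w1_def w2_def by linarith
qed

section \<open>From the acceptance probability to the final bound\<close>

lemma top_idx_subset: "top_idx t n u \<subseteq> {..<n}"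
  unfolding top_idx_def by auto

lemma good_dists_imp:
  assumes "good_dists k D0 D1"
  shows "finite (set_pmf D0)" "finite (set_pmf D1)" "same_moments k D0 D1"
proof -
  have "{x :: nat \<Rightarrow> bool. \<forall>i\<ge>k. \<not> x i} = PiE_dflt {..<k} False (\<lambda>_. UNIV)"
    by (auto simp: PiE_dflt_def not_less)
  then have "finite {x :: nat \<Rightarrow> bool. \<forall>i\<ge>k. \<not> x i}" by (simp add: finite_PiE_dflt)
  then show "finite (set_pmf D0)" "finite (set_pmf D1)"
    using assms unfolding good_dists_def by (auto intro: finite_subset)
  show "same_moments k D0 D1" using assms unfolding good_dists_def same_moments_def by blast
qed

text \<open>Acceptance means output 1 under \<open>D1\<close> or output 0 under \<open>D0\<close>,
  according to the bit; averaging over the bit leaves half of the distinguishing advantage.\<close>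

lemma accept_prob_eq:
  "accept_prob k R D0 D1 (halfspace k R w \<theta>) =
    1/2 + (measure_pmf.prob (noisy_matrix k R D1) {y. wsum k R w y \<ge> \<theta>} -
      measure_pmf.prob (noisy_matrix k R D0) {y. wsum k R w y \<ge> \<theta>}) / 2"
proof -
  define N where "N b = noisy_matrix k R (if b then D1 else D0)" for b
  define h where "h = halfspace k R w \<theta>"
  have hset: "{y. h y} = {y. wsum k R w y \<ge> \<theta>}"
    unfolding h_def halfspace_def wsum_def by auto
  have "dict_test k R D0 D1 h = bind_pmf (bernoulli_pmf (1/2)) (\<lambda>b. map_pmf (\<lambda>y. h y = b) (N b))"
    unfolding dict_test_def N_def noisy_matrix_def map_pmf_def bind_assoc_pmf by (simp add: if_distrib)
  then have "accept_prob k R D0 D1 h =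
      pmf (bind_pmf (bernoulli_pmf (1/2)) (\<lambda>b. map_pmf (\<lambda>y. h y = b) (N b))) True"
    unfolding accept_prob_def by (simp add: measure_pmf_single)
  also have "\<dots> = 1/2 * pmf (map_pmf (\<lambda>y. h y = True) (N True)) True + 1/2 * pmf (map_pmf (\<lambda>y. h y = False) (N False)) True"
    unfolding pmf_bind expectation_bool_pmf by simp
  also have "pmf (map_pmf (\<lambda>y. h y = True) (N True)) True = measure_pmf.prob (N True) {y. h y}"
    by (simp add: pmf_map vimage_def)
  also have "pmf (map_pmf (\<lambda>y. h y = False) (N False)) True = measure_pmf.prob (N False) (- {y. h y})"
    by (simp add: pmf_map vimage_def Collect_neg_eq)
  also have "\<dots> = 1 - measure_pmf.prob (N False) {y. h y}"
    using measure_pmf.prob_compl[of "{y. h y}" "N False"] by (simp add: Compl_eq_Diff_UNIV)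
  finally show ?thesis unfolding h_def[symmetric] hset N_def by (simp add: field_simps)
qed

theorem theorem4p6:
  shows "\<exists>C::real. \<forall>(k::nat) (R::nat) D0 D1 (w :: nat \<Rightarrow> nat \<Rightarrow> real) (\<theta>::real).
    (let \<tau> = 1 / real k ^ 7;
         t = (1 / \<tau>^2) * (3 * ln (1/\<tau>) + ln (real R))
             + real_of_int (\<lceil>4 * real k ^ 2 * ln (real k)\<rceil> * \<lceil>(4 / \<tau>^2) * ln (1/\<tau>)\<rceil>)
     in k \<ge> 2 \<and> R \<ge> 1 \<and> good_dists k D0 D1 \<and>
        (\<forall>i<k. \<forall>j<k. i \<noteq> j \<longrightarrow> top_idx t R (w i) \<inter> top_idx t R (w j) = {})
        \<longrightarrow> accept_prob k R D0 D1 (halfspace k R w \<theta>) \<le> 1/2 + C / real k)"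
proof (intro exI[of _ "2 + 2752 * pi"] allI, unfold Let_def, intro impI, elim conjE)
  fix k R :: nat and D0 D1 and w :: "nat \<Rightarrow> nat \<Rightarrow> real" and \<theta> :: real
  define \<tau> where "\<tau> = 1 / real k ^ 7"
  define s where "s = (1 / \<tau>^2) * (3 * ln (1/\<tau>) + ln (real R))"
  define m T where "m = nat \<lceil>4 * real k ^ 2 * ln (real k)\<rceil>" and "T = nat \<lceil>(4 / \<tau>^2) * ln (1/\<tau>)\<rceil>"
  define t where "t = s + real_of_int (\<lceil>4 * real k ^ 2 * ln (real k)\<rceil> * \<lceil>(4 / \<tau>^2) * ln (1/\<tau>)\<rceil>)"
  assume k: "k \<ge> 2" and R: "R \<ge> 1" and good: "good_dists k D0 D1"
    and "\<forall>i<k. \<forall>j<k. i \<noteq> j \<longrightarrow> top_idx ((1 / (1 / real k ^ 7)^2) * (3 * ln (1/(1 / real k ^ 7)) + ln (real R))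
             + real_of_int (\<lceil>4 * real k ^ 2 * ln (real k)\<rceil> * \<lceil>(4 / (1 / real k ^ 7)^2) * ln (1/(1 / real k ^ 7))\<rceil>)) R (w i)
           \<inter> top_idx ((1 / (1 / real k ^ 7)^2) * (3 * ln (1/(1 / real k ^ 7)) + ln (real R))
             + real_of_int (\<lceil>4 * real k ^ 2 * ln (real k)\<rceil> * \<lceil>(4 / (1 / real k ^ 7)^2) * ln (1/(1 / real k ^ 7))\<rceil>)) R (w j) = {}"
  then have disj: "top_idx t R (w i) \<inter> top_idx t R (w j) = {}" if "i < k" "j < k" "i \<noteq> j" for i j
    unfolding t_def s_def \<tau>_def using that by blast
  note gd = good_dists_imp[OF good]
  have "(2::real) ^ 7 \<le> real k ^ 7" using k by (intro power_mono) auto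
  then have k7: "128 \<le> real k ^ 7" by simp
  have \<tau>: "0 < \<tau>" "\<tau> \<le> 1/25" unfolding \<tau>_def using k7 k by (auto simp: field_simps)
  have lnt: "ln (1/\<tau>) > 0" using \<tau> by (simp add: field_simps)
  have lnk: "ln (real k) > 0" using k by simp
  have mpos: "4 * real k ^ 2 * ln (real k) > 0" using lnk k by simp
  have Tpos: "(4 / \<tau>^2) * ln (1/\<tau>) > 0" using lnt \<tau> by simp
  have m1: "m \<ge> 1" unfolding m_def using mpos by (simp add: Suc_le_eq)
  have T1: "T \<ge> 1" unfolding T_def using Tpos by (simp add: Suc_le_eq)
  have t: "t = s + real (m * T)"
    unfolding t_def m_def T_def using mpos Tpos by simp
  have s0: "s \<ge> 0" unfolding s_def using lnt R by (intro mult_nonneg_nonneg add_nonneg_nonneg) auto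
  \<comment> \<open>The second ceiling in \<open>t\<close> is a block length over which the energy
    decays by \<open>\<tau> ^ 4\<close>.\<close>
  have expT: "exp (- (\<tau>\<^sup>2 * real T)) \<le> \<tau> ^ 4"
  proof -
    have "(4 / \<tau>^2) * ln (1/\<tau>) \<le> real T" unfolding T_def by (rule real_nat_ceiling_ge)
    then have "\<tau>\<^sup>2 * ((4 / \<tau>^2) * ln (1/\<tau>)) \<le> \<tau>\<^sup>2 * real T" by (intro mult_left_mono) auto
    then have "4 * ln (1/\<tau>) \<le> \<tau>\<^sup>2 * real T" using \<tau> by simp
    then have "exp (- (\<tau>\<^sup>2 * real T)) \<le> exp (real 4 * ln \<tau>)" using \<tau> by (simp add: ln_div)
    also have "\<dots> = \<tau> ^ 4" unfolding exp_of_nat_mult using \<tau> by simp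
    finally show ?thesis .
  qed
  \<comment> \<open>In \<open>s\<close>, the term \<open>ln R\<close> cancels the factor
    \<open>R\<close> from Cauchy-Schwarz and \<open>3 * ln (1/\<tau>)\<close> yields
    \<open>\<tau> ^ 3\<close>.\<close>
  have exps: "exp (- (\<tau>\<^sup>2 * s)) * real R \<le> \<tau> ^ 3"
  proof -
    have "\<tau>\<^sup>2 * s = 3 * ln (1/\<tau>) + ln (real R)" unfolding s_def using \<tau> by simp
    then have "- (\<tau>\<^sup>2 * s) = real 3 * ln \<tau> - ln (real R)" using \<tau> by (simp add: ln_div)
    then have "exp (- (\<tau>\<^sup>2 * s)) = \<tau> ^ 3 / real R"
      unfolding exp_diff exp_of_nat_mult using \<tau> R by (simp add: exp_diff exp_of_nat_mult del: of_nat_numeral)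
    then show ?thesis using R by simp
  qed
  define reg where "reg i A \<longleftrightarrow> (\<forall>j\<in>{..<R} - A. (w i j)\<^sup>2 \<le> \<tau>\<^sup>2 * (\<Sum>j\<in>{..<R} - A. (w i j)\<^sup>2))" for i A
  have "\<exists>A. A \<subseteq> top_idx t R (w i) \<and> (reg i A \<or> geometric_head m R A (w i))" for i
    using critical_index_dichotomy[OF \<tau> m1 T1 s0 expT exps t, of "w i"]
  proof cases
    case (1 A)
    then show ?thesis unfolding reg_def by blast
  next
    case (2 g)
    then have "geometric_head m R (top_idx t R (w i)) (w i)"
      unfolding geometric_head_def by blast
    then show ?thesis by blast
  qed
  then obtain H where H: "\<And>i. H i \<subseteq> top_idx t R (w i)"
    "\<And>i. reg i (H i) \<or> geometric_head m R (H i) (w i)" by metis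
  define F where "F = {i. i < k \<and> \<not> reg i (H i)}"
  define w' where "w' = truncate_rows F H w"
  define p p' where "p D = measure_pmf.prob (noisy_matrix k R D) {y. wsum k R w y \<ge> \<theta>}"
    and "p' D = measure_pmf.prob (noisy_matrix k R D) {y. wsum k R w' y \<ge> \<theta>}" for D
  have F: "finite F" "F \<subseteq> {..<k}" unfolding F_def by auto
  have "(1::real) \<le> (real k)\<^sup>2" using k by simp
  then have q1: "1 / (2 * (real k)\<^sup>2) \<le> 1" by (simp add: divide_le_eq)
  \<comment> \<open>As \<open>m \<ge> 4 * k\<^sup>2 * ln k\<close>, the power is at most
    \<open>exp (- 2 * ln k)\<close>; a union over at most \<open>k\<close> rows then costs
    \<open>1 / k\<close>.\<close>
  have qm: "(1 - 1 / (2 * (real k)\<^sup>2)) ^ m \<le> 1 / (real k)\<^sup>2"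
  proof -
    have "(1 - 1 / (2 * (real k)\<^sup>2)) ^ m \<le> exp (- (1 / (2 * (real k)\<^sup>2))) ^ m"
      using q1 exp_ge_add_one_self[of "- (1 / (2 * (real k)\<^sup>2))"] by (intro power_mono) auto
    also have "\<dots> = exp (- (real m / (2 * (real k)\<^sup>2)))"
      by (simp flip: exp_of_nat_mult)
    also have "\<dots> \<le> exp (- (real 2 * ln (real k)))"
    proof -
      have "4 * real k ^ 2 * ln (real k) \<le> real m" unfolding m_def by (rule real_nat_ceiling_ge)
      then show ?thesis using k by (simp add: field_simps)
    qed
    also have "\<dots> = 1 / (real k)\<^sup>2"
      unfolding exp_minus exp_of_nat_mult using k by (simp add: inverse_eq_divide)
    finally show ?thesis .
  qed
  have trunc: "\<bar>p D - p' D\<bar> \<le> 1 / real k" if "finite (set_pmf D)" for D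
  proof -
    have "\<bar>p D - p' D\<bar> \<le> real (card F) * (1 - 1 / (2 * (real k)\<^sup>2)) ^ m"
      unfolding p_def p'_def w'_def
    proof (rule prob_truncate_rows[OF k that m1 F])
      show "H i \<subseteq> {..<R}" for i using H(1)[of i] top_idx_subset by blast
      show "geometric_head m R (H i) (w i)" if "i \<in> F" for i using that H(2)[of i] unfolding F_def by blast
    qed
    also have "\<dots> \<le> real k * (1 / (real k)\<^sup>2)"
      using qm q1 card_mono[OF _ F(2)] by (intro mult_mono zero_le_power) auto
    also have "\<dots> = 1 / real k" by (simp add: power2_eq_square)
    finally show ?thesis .
  qed
  have "\<bar>p' D1 - p' D0\<bar> \<le> (2 + 5504 * pi) / real k"
    unfolding p'_def
  proof (rule regular_rows_indistinguishable[OF k gd, where H = H])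
    show "H i \<inter> H i' = {}" if "i < k" "i' < k" "i \<noteq> i'" for i i'
      using disj[OF that] H(1)[of i] H(1)[of i'] by blast
    fix i j assume i: "i < k" and j: "j \<in> {..<R} - H i"
    show "(w' i j)\<^sup>2 \<le> (1 / real k ^ 7)\<^sup>2 * (\<Sum>j\<in>{..<R} - H i. (w' i j)\<^sup>2)"
    proof (cases "i \<in> F")
      case True
      \<comment> \<open>A truncated row has zero tail and is therefore trivially regular.\<close>
      then have "w' i j = 0" unfolding w'_def truncate_rows_def using j by simp
      then show ?thesis by (simp add: sum_nonneg)
    next
      case False
      then have "w' i = w i" unfolding w'_def truncate_rows_def by auto
      moreover have "reg i (H i)" using False i unfolding F_def by blast
      ultimately show ?thesis using j unfolding reg_def \<tau>_def by simp
    qed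
  qed
  then have "p D1 - p D0 \<le> (2 + 5504 * pi) / real k + 1 / real k + 1 / real k"
    using trunc[OF gd(1)] trunc[OF gd(2)] by linarith
  \<comment> \<open>Indistinguishability costs \<open>2 + 5504 * pi\<close> and the two truncations
    1 each; half of the total is the constant \<open>2 + 2752 * pi\<close>.\<close>
  also have "\<dots> = 2 * ((2 + 2752 * pi) / real k)" using k by (simp add: field_simps)
  finally show "accept_prob k R D0 D1 (halfspace k R w \<theta>) \<le> 1/2 + (2 + 2752 * pi) / real k"
    unfolding accept_prob_eq p_def by simp
qed

end
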